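(* Let $(\theta_t)_{t\in\mathbb R}$ be a smooth green path and $M\in\mathcal G$. Then there exist real numbers $t_1>t_2>\cdots>t_m$ and strict subobjects $M=M_0\supseteq M_1\supseteq\cdots\supseteq M_m=0$ of $M$ such that $M_{k-1}/M_k\in\mathcal W(\theta_{t_k})$ for $k=1,\dots,m$. Furthermore, each quotient $M_{k-1}/M_k$ has a chain of strict subobjects $0=N_0\subseteq N_1\subseteq\cdots\subseteq N_r=M_{k-1}/M_k$ with every $N_j/N_{j-1}\in\mathcal W_0(\theta_{t_k})$.
   Context: Let $\Lambda$ be a finite dimensional algebra over a field with $n$ isoclasses of simple modules, and $\mathrm{mod}\text-\Lambda$ the category of finitely generated right $\Lambda$-modules. Fix a torsion class $\mathcal G\subseteq\mathrm{mod}\text-\Lambda$ (closed under isomorphisms, extensions and quotients). For $B\in\mathcal G$, a subobject of $B$ is a submodule in $\mathcal G$; a subobject $A\subseteq B$ is strict if $A\cap B'\in\mathcal G$ for every subobject $B'$ of $B$; a strict quotient of $B$ is $B/A$ with $A$ a strict subobject. Let $V_\Lambda=\mathrm{Hom}_{\mathbb Z}(K_0\Lambda,\mathbb R)\cong\mathbb R^n$; $\theta(M)$ denotes $\theta$ applied to the dimension vector of $M$. For $M\in\mathcal G$, $D_{\mathcal G}(M)$ is the set of $\theta$ with $\theta(M)=0$ and $\theta(M')\le0$ for every strict subobject $M'$ of $M$. $\mathcal W(\theta)$ is the class of $X\in\mathcal G$ with $\theta\in D_{\mathcal G}(X)$, and $\mathcal W_0(\theta)$ is the class of nonzero $X\in\mathcal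 W(\theta)$ such that no nonzero proper strict subobject of $X$ lies in $\mathcal W(\theta)$. A smooth green path is a smooth map $t\mapsto\theta_t$, $\mathbb R\to V_\Lambda$, such that: (1) whenever $\theta_{t_0}\in D_{\mathcal G}(M)$ for some nonzero $M\in\mathcal G$, $\frac{d}{dt}\theta_t(M)|_{t=t_0}>0$; (2) there is $T$ such that $\theta_t(M)>0$ for all $t>T$ and all nonzero $M\in\mathcal G$; (3) there is $T'$ such that $\theta_t(M)<0$ for all $t<T'$ and all nonzero $M\in\mathcal G$. *)

theory Defs
  imports "HOL-Analysis.Analysis"
begin

text \<open>A finite dimensional (associative, unital) algebra Lambda over the field 'k is given by
  its dimension d, structure constants c (e_i e_j = sum_l c i j l e_l, for the basis e_0..e_(d-1))
  and the coordinates u of the unit element.\<close>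

definition fd_algebra :: "nat \<Rightarrow> (nat \<Rightarrow> nat \<Rightarrow> nat \<Rightarrow> 'k::field) \<Rightarrow> (nat \<Rightarrow> 'k) \<Rightarrow> bool" where
  "fd_algebra d c u \<longleftrightarrow>
     (\<forall>i<d. \<forall>j<d. \<forall>k<d. \<forall>p<d.
        (\<Sum>l<d. c i j l * c l k p) = (\<Sum>l<d. c j k l * c i l p)) \<and>
     (\<forall>j<d. \<forall>p<d. (\<Sum>i<d. u i * c i j p) = (if j = p then 1 else 0)) \<and>
     (\<forall>j<d. \<forall>p<d. (\<Sum>i<d. u i * c j i p) = (if j = p then 1 else 0))"

text \<open>A (finite dimensional = finitely generated) right Lambda-module is K^m (row vectors)
  together with matrices A i (the action of e_i): v . e_i = v * A i.\<close>

type_synonym 'k modl = "nat \<times> (nat \<Rightarrow> nat \<Rightarrow> nat \<Rightarrow> 'k)"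

definition vecs :: "nat \<Rightarrow> (nat \<Rightarrow> 'k::field) set" where
  "vecs m = {v. \<forall>i\<ge>m. v i = 0}"

definition vmul :: "nat \<Rightarrow> nat \<Rightarrow> (nat \<Rightarrow> 'k::field) \<Rightarrow> (nat \<Rightarrow> nat \<Rightarrow> 'k) \<Rightarrow> nat \<Rightarrow> 'k" where
  "vmul m n v F = (\<lambda>q. if q < n then (\<Sum>p<m. v p * F p q) else 0)"

definition is_module :: "nat \<Rightarrow> (nat \<Rightarrow> nat \<Rightarrow> nat \<Rightarrow> 'k::field) \<Rightarrow> (nat \<Rightarrow> 'k) \<Rightarrow> 'k modl \<Rightarrow> bool" where
  "is_module d c u M \<longleftrightarrow> (case M of (m, A) \<Rightarrow>
     (\<forall>i<d. \<forall>j<d. \<forall>p<m. \<forall>q<m.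
        (\<Sum>r<m. A i p r * A j r q) = (\<Sum>l<d. c i j l * A l p q)) \<and>
     (\<forall>p<m. \<forall>q<m. (\<Sum>i<d. u i * A i p q) = (if p = q then 1 else 0)))"

definition mdim :: "'k modl \<Rightarrow> nat" where "mdim M = fst M"

definition act :: "nat \<Rightarrow> 'k::field modl \<Rightarrow> (nat \<Rightarrow> 'k) \<Rightarrow> nat \<Rightarrow> 'k" where
  "act i M v = vmul (fst M) (fst M) v (snd M i)"

definition zerov :: "nat \<Rightarrow> 'k::field" where "zerov = (\<lambda>_. 0)"

definition submodule :: "nat \<Rightarrow> 'k::field modl \<Rightarrow> (nat \<Rightarrow> 'k) set \<Rightarrow> bool" where
  "submodule d M U \<longleftrightarrow> U \<subseteq> vecs (fst M) \<and> zerov \<in> U \<and>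
     (\<forall>v\<in>U. \<forall>w\<in>U. (\<lambda>q. v q + w q) \<in> U) \<and>
     (\<forall>a. \<forall>v\<in>U. (\<lambda>q. a * v q) \<in> U) \<and>
     (\<forall>i<d. \<forall>v\<in>U. act i M v \<in> U)"

text \<open>subquot_iso d M U V N: N is isomorphic to the subquotient U/V of M, i.e. there is a
  surjective module homomorphism U \<rightarrow> N (given by a matrix F) with kernel V.\<close>
definition subquot_iso :: "nat \<Rightarrow> 'k::field modl \<Rightarrow> (nat \<Rightarrow> 'k) set \<Rightarrow> (nat \<Rightarrow> 'k) set \<Rightarrow> 'k modl \<Rightarrow> bool" where
  "subquot_iso d M U V N \<longleftrightarrow> (\<exists>F.
     (\<forall>i<d. \<forall>v\<in>U. vmul (fst M) (fst N) (act i M v) F = act i N (vmul (fst M) (fst N) v F)) \<and>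
     (\<lambda>v. vmul (fst M) (fst N) v F) ` U = vecs (fst N) \<and>
     {v\<in>U. vmul (fst M) (fst N) v F = zerov} = V)"

definition torsion_class :: "nat \<Rightarrow> (nat \<Rightarrow> nat \<Rightarrow> nat \<Rightarrow> 'k::field) \<Rightarrow> (nat \<Rightarrow> 'k) \<Rightarrow> 'k modl set \<Rightarrow> bool" where
  "torsion_class d c u G \<longleftrightarrow>
     G \<subseteq> {N. is_module d c u N} \<and>
     \<comment> \<open>closed under isomorphisms\<close>
     (\<forall>N Q. N \<in> G \<and> is_module d c u Q \<and> subquot_iso d N (vecs (fst N)) {zerov} Q \<longrightarrow> Q \<in> G) \<and>
     \<comment> \<open>closed under quotients\<close>
     (\<forall>N U Q. N \<in> G \<and> submodule d N U \<and> is_module d c u Q \<and> subquot_iso d N (vecs (fst N)) U Q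
        \<longrightarrow> Q \<in> G) \<and>
     \<comment> \<open>closed under extensions\<close>
     (\<forall>N U L Q. is_module d c u N \<and> submodule d N U \<and> L \<in> G \<and> Q \<in> G \<and>
        subquot_iso d N U {zerov} L \<and> subquot_iso d N (vecs (fst N)) U Q \<longrightarrow> N \<in> G)"

definition sub_in :: "nat \<Rightarrow> (nat \<Rightarrow> nat \<Rightarrow> nat \<Rightarrow> 'k::field) \<Rightarrow> (nat \<Rightarrow> 'k) \<Rightarrow> 'k modl set \<Rightarrow> 'k modl \<Rightarrow> (nat \<Rightarrow> 'k) set \<Rightarrow> bool" where
  "sub_in d c u G N U \<longleftrightarrow> (\<exists>L. is_module d c u L \<and> subquot_iso d N U {zerov} L \<and> L \<in> G)"

definition subobject :: "nat \<Rightarrow> (nat \<Rightarrow> nat \<Rightarrow> nat \<Rightarrow> 'k::field) \<Rightarrow> (nat \<Rightarrow> 'k) \<Rightarrow> 'k modl set \<Rightarrow> 'k modl \<Rightarrow> (nat \<Rightarrow> 'k) set \<Rightarrow> bool" where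
  "subobject d c u G N U \<longleftrightarrow> submodule d N U \<and> sub_in d c u G N U"

definition strict_subobject :: "nat \<Rightarrow> (nat \<Rightarrow> nat \<Rightarrow> nat \<Rightarrow> 'k::field) \<Rightarrow> (nat \<Rightarrow> 'k) \<Rightarrow> 'k modl set \<Rightarrow> 'k modl \<Rightarrow> (nat \<Rightarrow> 'k) set \<Rightarrow> bool" where
  "strict_subobject d c u G N U \<longleftrightarrow> subobject d c u G N U \<and>
     (\<forall>U'. subobject d c u G N U' \<longrightarrow> sub_in d c u G N (U \<inter> U'))"

text \<open>An element of Hom(K_0 Lambda, R) is the same as a real valued function on modules which is
  additive on short exact sequences (universal property of the Grothendieck group).\<close>
definition additive :: "nat \<Rightarrow> (nat \<Rightarrow> nat \<Rightarrow> nat \<Rightarrow> 'k::field) \<Rightarrow> (nat \<Rightarrow> 'k) \<Rightarrow> ('k modl \<Rightarrow> real) \<Rightarrow> bool" where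
  "additive d c u \<theta> \<longleftrightarrow> (\<forall>N U L Q. is_module d c u N \<and> submodule d N U \<and>
     is_module d c u L \<and> is_module d c u Q \<and>
     subquot_iso d N U {zerov} L \<and> subquot_iso d N (vecs (fst N)) U Q \<longrightarrow> \<theta> N = \<theta> L + \<theta> Q)"

definition in_D :: "nat \<Rightarrow> (nat \<Rightarrow> nat \<Rightarrow> nat \<Rightarrow> 'k::field) \<Rightarrow> (nat \<Rightarrow> 'k) \<Rightarrow> 'k modl set \<Rightarrow> ('k modl \<Rightarrow> real) \<Rightarrow> 'k modl \<Rightarrow> bool" where
  "in_D d c u G \<theta> M \<longleftrightarrow> \<theta> M = 0 \<and>
     (\<forall>U L. strict_subobject d c u G M U \<and> is_module d c u L \<and> subquot_iso d M U {zerov} L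
        \<longrightarrow> \<theta> L \<le> 0)"

definition in_W :: "nat \<Rightarrow> (nat \<Rightarrow> nat \<Rightarrow> nat \<Rightarrow> 'k::field) \<Rightarrow> (nat \<Rightarrow> 'k) \<Rightarrow> 'k modl set \<Rightarrow> ('k modl \<Rightarrow> real) \<Rightarrow> 'k modl \<Rightarrow> bool" where
  "in_W d c u G \<theta> X \<longleftrightarrow> X \<in> G \<and> in_D d c u G \<theta> X"

definition in_W0 :: "nat \<Rightarrow> (nat \<Rightarrow> nat \<Rightarrow> nat \<Rightarrow> 'k::field) \<Rightarrow> (nat \<Rightarrow> 'k) \<Rightarrow> 'k modl set \<Rightarrow> ('k modl \<Rightarrow> real) \<Rightarrow> 'k modl \<Rightarrow> bool" where
  "in_W0 d c u G \<theta> X \<longleftrightarrow> in_W d c u G \<theta> X \<and> fst X \<noteq> 0 \<and>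
     \<not> (\<exists>U L. strict_subobject d c u G X U \<and> U \<noteq> {zerov} \<and> U \<noteq> vecs (fst X) \<and>
            is_module d c u L \<and> subquot_iso d X U {zerov} L \<and> in_W d c u G \<theta> L)"

definition smooth_real :: "(real \<Rightarrow> real) \<Rightarrow> bool" where
  "smooth_real f \<longleftrightarrow> (\<forall>k x. ((deriv ^^ k) f) differentiable (at x))"

text \<open>A smooth path in V_Lambda: each theta_t is additive, and t \<mapsto> theta_t(M) is smooth for each
  module M (equivalently, the coordinates theta_t(S_i) at the simples are smooth).\<close>
definition smooth_green_path :: "nat \<Rightarrow> (nat \<Rightarrow> nat \<Rightarrow> nat \<Rightarrow> 'k::field) \<Rightarrow> (nat \<Rightarrow> 'k) \<Rightarrow> 'k modl set \<Rightarrow> (real \<Rightarrow> 'k modl \<Rightarrow> real) \<Rightarrow> bool" where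
  "smooth_green_path d c u G \<theta> \<longleftrightarrow>
     (\<forall>t. additive d c u (\<theta> t)) \<and>
     (\<forall>M. is_module d c u M \<longrightarrow> smooth_real (\<lambda>t. \<theta> t M)) \<and>
     (\<forall>t0 M. M \<in> G \<and> fst M \<noteq> 0 \<and> in_D d c u G (\<theta> t0) M \<longrightarrow> deriv (\<lambda>t. \<theta> t M) t0 > 0) \<and>
     (\<exists>T. \<forall>t>T. \<forall>M. M \<in> G \<and> fst M \<noteq> 0 \<longrightarrow> \<theta> t M > 0) \<and>
     (\<exists>T'. \<forall>t<T'. \<forall>M. M \<in> G \<and> fst M \<noteq> 0 \<longrightarrow> \<theta> t M < 0)"

end

theory Submission
  imports Defs "HOL-Library.Function_Algebras"
begin

text \<open>Everything happens in the modular lattice of submodules of \<open>M\<close>, where a subquotient is a pair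
  \<open>V \<subseteq> U\<close> and \<open>h t U V\<close> denotes \<open>\<theta>\<^sub>t(U/V)\<close>. For large \<open>t\<close> every nonzero strict quotient \<open>U/B\<close>
  is positive. Only finitely many functions \<open>t \<mapsto> \<theta>\<^sub>t(U/B)\<close> occur, so, moving \<open>t\<close> down, there is a last
  time \<open>s\<close> at which one of them vanishes while all the others are still nonnegative. For a smallest
  \<open>B\<close> with \<open>\<theta>\<^sub>s(U/B) = 0\<close> the quotient \<open>U/B\<close> lies in \<open>W(\<theta>\<^sub>s)\<close>, and by minimality all proper strict
  quotients of \<open>B\<close> are positive at \<open>s\<close>; repeating the argument with \<open>B\<close> below \<open>s\<close> gives the filtration
  with strictly decreasing times. An object of \<open>W(\<theta>\<^sub>s)\<close> is refined by splitting off a smallest nonzero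
  strict subobject in \<open>W(\<theta>\<^sub>s)\<close>.\<close>

section \<open>Row vectors and matrices\<close>

text \<open>Addition and zero of row vectors are the pointwise ones on functions, so naming the
  scalar action suffices to enter the theory of abstract vector spaces.\<close>

definition vscale :: "'k::field \<Rightarrow> (nat \<Rightarrow> 'k) \<Rightarrow> nat \<Rightarrow> 'k" where
  "vscale a v = (\<lambda>q. a * v q)"

lemma vscale_apply: "vscale a v q = a * v q"
  by (simp add: vscale_def)

interpretation fv: vector_space vscale
  by standard (auto simp: vscale_def fun_eq_iff algebra_simps)

interpretation fp: vector_space_pair vscale vscale
  by standard

lemma sum_apply: "(\<Sum>i\<in>S. f i) q = (\<Sum>i\<in>S. f i q)"
  by (induction S rule: infinite_finite_induct) auto

definition unitv :: "nat \<Rightarrow> nat \<Rightarrow> 'k::field" where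
  "unitv i = (\<lambda>q. if q = i then 1 else 0)"

lemma zerov_eq_0: "zerov = 0"
  by (simp add: zerov_def zero_fun_def)

lemma unitv_in_vecs: "i < m \<Longrightarrow> unitv i \<in> vecs m"
  by (auto simp: unitv_def vecs_def)

lemma vecs_expand:
  assumes "v \<in> vecs m"
  shows "v = (\<Sum>i<m. vscale (v i) (unitv i))"
proof
  fix q
  have "(\<Sum>i<m. v i * unitv i q) = (\<Sum>i<m. if i = q then v i else 0)"
    by (intro sum.cong) (auto simp: unitv_def)
  also have "\<dots> = v q"
    using assms by (auto simp: vecs_def)
  finally show "v q = (\<Sum>i<m. vscale (v i) (unitv i)) q"
    by (simp add: sum_apply vscale_apply)
qed

lemma subspace_vecs: "fv.subspace (vecs m)"
  by (auto simp: fv.subspace_def vecs_def vscale_def)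

lemma span_unitv: "fv.span (unitv ` {..<m}) = vecs m" (is "?L = ?R")
proof
  show "?L \<subseteq> ?R"
    by (intro fv.span_minimal subspace_vecs) (auto simp: unitv_in_vecs)
  show "?R \<subseteq> ?L"
  proof
    fix v assume "v \<in> ?R"
    then have "v = (\<Sum>i<m. vscale (v i) (unitv i))" by (rule vecs_expand)
    also have "\<dots> \<in> ?L"
      by (intro fv.span_sum fv.span_scale fv.span_base) auto
    finally show "v \<in> ?L" .
  qed
qed

lemma vmul_in_vecs: "vmul m n v F \<in> vecs n"
  by (auto simp: vmul_def vecs_def)

lemma vmul_add: "vmul m n (v + w) F = vmul m n v F + vmul m n w F"
  by (auto simp: vmul_def fun_eq_iff sum.distrib algebra_simps)

lemma vmul_scale: "vmul m n (vscale a v) F = vscale a (vmul m n v F)"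
  by (auto simp: vmul_def vscale_def fun_eq_iff sum_distrib_left algebra_simps)

lemma vmul_zero: "vmul m n 0 F = 0"
  by (auto simp: vmul_def fun_eq_iff)

lemma vmul_diff: "vmul m n (v - w) F = vmul m n v F - vmul m n w F"
  by (auto simp: vmul_def fun_eq_iff sum_subtractf algebra_simps)

lemma vmul_sum: "vmul m n (\<Sum>i\<in>S. f i) F = (\<Sum>i\<in>S. vmul m n (f i) F)"
  by (induction S rule: infinite_finite_induct) (simp_all only: vmul_zero vmul_add sum.infinite sum.empty sum.insert not_False_eq_True)

lemma vmul_unitv: "p < m \<Longrightarrow> vmul m n (unitv p) F = (\<lambda>q. if q < n then F p q else 0)"
  by (rule ext) (simp add: vmul_def unitv_def if_distrib[where f="\<lambda>x. x * _"] cong: if_cong)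

lemma vmul_vmul:
  "vmul m n (vmul l m v F) H = vmul l n v (\<lambda>p q. \<Sum>r<m. F p r * H r q)"
proof -
  have "(\<Sum>r<m. (\<Sum>p<l. v p * F p r) * H r q) = (\<Sum>p<l. v p * (\<Sum>r<m. F p r * H r q))" for q
    by (simp add: sum_distrib_right sum_distrib_left mult.assoc) (rule sum.swap)
  then show ?thesis by (auto simp: vmul_def fun_eq_iff)
qed

lemma vmul_identity:
  assumes "v \<in> vecs m"
  shows "vmul m m v (\<lambda>p q. if p = q then 1 else 0) = v"
proof
  fix q
  show "vmul m m v (\<lambda>p q. if p = q then 1 else 0) q = v q"
    using assms
    by (simp add: vmul_def vecs_def if_distrib[where f="\<lambda>x. _ * x"] cong: if_cong)
qed

text \<open>The rows of the matrix are the images of the unit vectors. Membership in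
  \<open>vecs m\<close> is asked of \<open>f v\<close> alone, because a map extended linearly from a
  basis may leave \<open>vecs m\<close> elsewhere.\<close>

lemma linear_eq_vmul:
  assumes f: "Vector_Spaces.linear vscale vscale f" and fv: "f v \<in> vecs m" and v: "v \<in> vecs n"
  shows "vmul n m v (\<lambda>p. f (unitv p)) = f v"
proof -
  interpret f: Vector_Spaces.linear vscale vscale f by (rule f)
  have "f v = f (\<Sum>i<n. vscale (v i) (unitv i))" using vecs_expand[OF v] by simp
  also have "\<dots> = (\<Sum>i<n. vscale (v i) (f (unitv i)))" by (simp add: f.sum f.scale)
  finally have "f v q = (\<Sum>i<n. v i * f (unitv i) q)" for q
    by (simp add: sum_apply vscale_apply)
  then show ?thesis
    using fv by (auto simp: vmul_def fun_eq_iff vecs_def)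
qed

section \<open>Bases, dimension and quotients of subspaces\<close>

lemma independent_finite_in_vecs: "fv.independent C \<Longrightarrow> C \<subseteq> vecs n \<Longrightarrow> finite C"
  using fv.independent_span_bound[of "unitv ` {..<n}" C] by (simp add: span_unitv)

lemma basis_extension:
  assumes "fv.subspace V" "fv.subspace U" "V \<subseteq> U"
  obtains B C where "B \<subseteq> C" "fv.independent C" "fv.span B = V" "fv.span C = U"
proof -
  obtain B where B: "B \<subseteq> V" "fv.independent B" "V \<subseteq> fv.span B"
    using fv.basis_exists by metis
  obtain C where C: "B \<subseteq> C" "C \<subseteq> U" "fv.independent C" "U \<subseteq> fv.span C"
    using fv.maximal_independent_subset_extend[of B U] B assms by blast
  show ?thesis
    using that[of B C] B C fv.span_minimal[of B V] fv.span_minimal[of C U] assms by blast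
qed

text \<open>The space of all sequences has infinite dimension, so finiteness of bases comes from
  \<open>U\<close> lying in \<open>vecs n\<close>. A basis of \<open>V\<close> is then a proper
  subset of a finite basis of \<open>U\<close>.\<close>

lemma dim_strict_mono:
  assumes "fv.subspace V" "fv.subspace U" "V \<subset> U" "U \<subseteq> vecs n"
  shows "fv.dim V < fv.dim U"
proof -
  obtain B C where BC: "B \<subseteq> C" "fv.independent C" "fv.span B = V" "fv.span C = U"
    using basis_extension[of V U] assms by blast
  have "C \<subseteq> vecs n" using BC(4) fv.span_superset assms(4) by blast
  then have "finite C" using BC(2) independent_finite_in_vecs by blast
  moreover have "B \<noteq> C" using BC assms(3) by auto
  ultimately have "card B < card C" using BC(1) by (simp add: psubset_card_mono psubset_eq)
  moreover have "fv.independent B" using BC fv.independent_mono by blast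
  ultimately show ?thesis using BC fv.dim_span_eq_card_independent by metis
qed

text \<open>A basis \<open>B\<close> of \<open>V\<close> is extended to a basis \<open>C\<close> of
  \<open>U\<close>; the matrix kills \<open>B\<close> and carries \<open>C - B\<close> bijectively
  to unit vectors.\<close>

lemma quotient_matrix_exists:
  assumes "fv.subspace V" "fv.subspace U" "V \<subseteq> U" "U \<subseteq> vecs n"
  shows "\<exists>m F. (\<lambda>v. vmul n m v F) ` U = vecs m \<and> {v\<in>U. vmul n m v F = 0} = V"
proof -
  obtain B C where BC: "B \<subseteq> C" "fv.independent C" "fv.span B = V" "fv.span C = U"
    using basis_extension[OF assms(1-3)] by metis
  have "C \<subseteq> vecs n" using BC(4) fv.span_superset assms(4) by blast
  then have fC: "finite C" using BC(2) independent_finite_in_vecs by blast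
  define m where "m = card (C - B)"
  obtain e where e: "bij_betw e (C - B) {..<m}"
    using fC ex_bij_betw_finite_nat[of "C - B"] by (auto simp: m_def atLeast0LessThan)
  obtain f where f: "Vector_Spaces.linear vscale vscale f" and fB: "\<And>x. x \<in> C \<Longrightarrow> f x = (if x \<in> B then 0 else unitv (e x))"
    using fp.linear_independent_extend[OF BC(2), of "\<lambda>x. if x \<in> B then 0 else unitv (e x)"] by auto
  interpret f: Vector_Spaces.linear vscale vscale f by (rule f)
  have "unitv i \<in> f ` C" if i: "i < m" for i
  proof -
    obtain x where "x \<in> C - B" "i = e x" using e i by (auto simp: bij_betw_def)
    then show ?thesis using fB[of x] by (intro image_eqI[of _ _ x]) auto
  qed
  then have "unitv ` {..<m} \<subseteq> f ` C" by blast
  moreover have "f x \<in> vecs m" if "x \<in> C" for x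
  proof (cases "x \<in> B")
    case True
    then show ?thesis using fB[OF that] fv.subspace_0[OF subspace_vecs] by simp
  next
    case False
    then have "e x < m" using e that by (auto simp: bij_betw_def)
    then show ?thesis using fB[OF that] False by (simp add: unitv_in_vecs)
  qed
  then have "f ` C \<subseteq> vecs m" by blast
  ultimately have "fv.span (f ` C) = vecs m"
    using fv.span_mono[of "unitv ` {..<m}" "f ` C"] fv.span_minimal[OF _ subspace_vecs, of "f ` C" m]
    unfolding span_unitv by blast
  then have fU: "f ` U = vecs m" using f.span_image[of C] BC by simp
  have ker: "v \<in> V" if v: "v \<in> U" "f v = 0" for v
  proof -
    obtain a where a: "v = (\<Sum>x\<in>C. vscale (a x) x)"
      using v(1) unfolding BC(4)[symmetric] fv.span_finite[OF fC] by blast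
    \<comment> \<open>Since \<open>e\<close> is injective on \<open>C - B\<close>, the coordinate
      \<open>e y\<close> of \<open>f v\<close> is exactly the coefficient of
      \<open>y\<close>.\<close>
    have "a y = 0" if y: "y \<in> C - B" for y
    proof -
      have "0 = f v (e y)" using v by simp
      also have "\<dots> = (\<Sum>x\<in>C. a x * f x (e y))" by (simp add: a f.sum f.scale sum_apply vscale_apply)
      also have "\<dots> = (\<Sum>x\<in>C. if x = y then a y else 0)"
        using e y by (intro sum.cong) (auto simp: fB unitv_def bij_betw_def inj_on_def)
      also have "\<dots> = a y" using fC y by simp
      finally show ?thesis by simp
    qed
    then have "v = (\<Sum>x\<in>B. vscale (a x) x)"
      unfolding a using fC BC(1) by (intro sum.mono_neutral_right) (auto simp: vscale_def zero_fun_def)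
    also have "\<dots> \<in> V" unfolding BC(3)[symmetric]
      by (intro fv.span_sum fv.span_scale fv.span_base)
    finally show ?thesis .
  qed
  have zero: "f v = 0" if "v \<in> V" for v
    using f.eq_0_on_span[of B v] fB BC(1,3) that by (metis subsetD)
  have "vmul n m v (\<lambda>p. f (unitv p)) = f v" if "v \<in> U" for v
    using that fU assms(4) by (intro linear_eq_vmul f) auto
  moreover have "{v\<in>U. f v = 0} = V" using ker zero assms(3) by blast
  ultimately show ?thesis using fU
    by (intro exI[of _ m] exI[of _ "\<lambda>p. f (unitv p)"]) (simp cong: image_cong conj_cong)
qed

section \<open>Subquotients of modules\<close>

definition vsum :: "(nat \<Rightarrow> 'k::field) set \<Rightarrow> (nat \<Rightarrow> 'k) set \<Rightarrow> (nat \<Rightarrow> 'k) set" where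
  "vsum A B = {a + b | a b. a \<in> A \<and> b \<in> B}"

lemma subset_vsum:
  shows subset_vsum1: "0 \<in> B \<Longrightarrow> A \<subseteq> vsum A B"
    and subset_vsum2: "0 \<in> A \<Longrightarrow> B \<subseteq> vsum A B"
proof -
  show "A \<subseteq> vsum A B" if "0 \<in> B"
  proof
    fix a assume "a \<in> A"
    moreover have "a = a + 0" by simp
    ultimately show "a \<in> vsum A B" using that unfolding vsum_def by blast
  qed
  show "B \<subseteq> vsum A B" if "0 \<in> A"
  proof
    fix b assume "b \<in> B"
    moreover have "b = 0 + b" by simp
    ultimately show "b \<in> vsum A B" using that unfolding vsum_def by blast
  qed
qed

section \<open>Submodules and a coordinate-free form of the module axioms\<close>

lemma submodule_iff:
  "submodule d M U \<longleftrightarrow> fv.subspace U \<and> U \<subseteq> vecs (fst M) \<and> (\<forall>i<d. \<forall>v\<in>U. act i M v \<in> U)"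
  unfolding submodule_def fv.subspace_def zerov_eq_0 plus_fun_def vscale_def by blast

lemma act_in_vecs: "act i M v \<in> vecs (fst M)"
  by (simp add: act_def vmul_in_vecs)

lemma act_add: "act i M (v + w) = act i M v + act i M w"
  by (simp add: act_def vmul_add)

lemma act_zero: "act i M 0 = 0"
  by (simp add: act_def vmul_zero)

lemma submodule_vecs: "submodule d M (vecs (fst M))"
  by (simp add: submodule_iff subspace_vecs act_in_vecs)

lemma submodule_zero: "submodule d M {0}"
  by (auto simp: submodule_iff act_zero vecs_def fv.subspace_def)

lemma submodule_Int: "submodule d M U \<Longrightarrow> submodule d M V \<Longrightarrow> submodule d M (U \<inter> V)"
  by (auto simp: submodule_iff fv.subspace_inter)

lemma submodule_vsum:
  assumes U: "submodule d M U" and V: "submodule d M V"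
  shows "submodule d M (vsum U V)"
proof -
  have "fv.subspace (vsum U V)"
    using fv.subspace_sums[of U V] assms by (simp add: vsum_def submodule_iff)
  moreover have "vsum U V \<subseteq> vecs (fst M)"
  proof
    fix x assume "x \<in> vsum U V"
    then obtain a b where "a \<in> U" "b \<in> V" "x = a + b" unfolding vsum_def by blast
    then show "x \<in> vecs (fst M)"
      using assms fv.subspace_add[OF subspace_vecs] unfolding submodule_iff by blast
  qed
  moreover have "act i M x \<in> vsum U V" if i: "i < d" and x: "x \<in> vsum U V" for i x
  proof -
    obtain a b where "a \<in> U" "b \<in> V" "x = a + b" using x unfolding vsum_def by blast
    then show ?thesis
      using assms i act_add[of i M a b] unfolding vsum_def submodule_iff by blast
  qed
  ultimately show ?thesis by (simp add: submodule_iff)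
qed

text \<open>Matrix identities become operator identities, because matrices with the same effect on
  all row vectors have the same entries. As the action is on the right, the product of the basis
  elements \<open>i\<close> and \<open>j\<close> acts by \<open>act i\<close> first and
  \<open>act j\<close> second.\<close>

lemma is_module_iff:
  "is_module d c u N \<longleftrightarrow>
     (\<forall>i<d. \<forall>j<d. \<forall>v\<in>vecs (fst N).
        act j N (act i N v) = (\<Sum>l<d. vscale (c i j l) (act l N v))) \<and>
     (\<forall>v\<in>vecs (fst N). (\<Sum>i<d. vscale (u i) (act i N v)) = v)"
proof -
  obtain m A where N: "N = (m, A)" by force
  have prod: "act j N (act i N v) = vmul m m v (\<lambda>p q. \<Sum>r<m. A i p r * A j r q)" for i j v
    by (simp add: act_def N vmul_vmul)
  have comb: "(\<Sum>l<d. vscale (f l) (act l N v)) = vmul m m v (\<lambda>p q. \<Sum>l<d. f l * A l p q)" for f v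
  proof
    fix q
    have "(\<Sum>l<d. f l * (\<Sum>p<m. v p * A l p q)) = (\<Sum>p<m. v p * (\<Sum>l<d. f l * A l p q))"
      by (simp add: sum_distrib_left mult.left_commute) (rule sum.swap)
    then show "(\<Sum>l<d. vscale (f l) (act l N v)) q = vmul m m v (\<lambda>p q. \<Sum>l<d. f l * A l p q) q"
      by (simp add: sum_apply vscale_apply act_def N vmul_def)
  qed
  have ext: "(\<forall>v\<in>vecs m. vmul m m v P = vmul m m v Q) \<longleftrightarrow> (\<forall>p<m. \<forall>q<m. P p q = Q p q)"
    for P Q :: "nat \<Rightarrow> nat \<Rightarrow> 'a"
  proof
    assume *: "\<forall>v\<in>vecs m. vmul m m v P = vmul m m v Q"
    show "\<forall>p<m. \<forall>q<m. P p q = Q p q"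
    proof (intro allI impI)
      fix p q assume "p < m" "q < m"
      then show "P p q = Q p q"
        using fun_cong[OF bspec[OF * unitv_in_vecs[of p m]], of q] by (simp add: vmul_unitv)
    qed
  qed (auto simp: vmul_def fun_eq_iff intro!: sum.cong)
  have unit: "(\<forall>v\<in>vecs m. vmul m m v P = v) \<longleftrightarrow>
      (\<forall>v\<in>vecs m. vmul m m v P = vmul m m v (\<lambda>p q. if p = q then 1 else 0))"
    for P :: "nat \<Rightarrow> nat \<Rightarrow> 'a"
    by (simp add: vmul_identity)
  show ?thesis
    unfolding prod comb unfolding N fst_conv unit ext is_module_def by simp
qed

text \<open>Names the homomorphism hidden in \<open>subquot_iso\<close>, so that submodules can be
  moved along it by images and preimages. The matrix acts on the whole space, but compatibility with
  the action is demanded on \<open>U\<close>.\<close>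

definition presents :: "nat \<Rightarrow> 'k::field modl \<Rightarrow> (nat \<Rightarrow> 'k) set \<Rightarrow> (nat \<Rightarrow> 'k) set \<Rightarrow> 'k modl
    \<Rightarrow> ((nat \<Rightarrow> 'k) \<Rightarrow> nat \<Rightarrow> 'k) \<Rightarrow> bool" where
  "presents d M U V N f \<longleftrightarrow>
     (\<exists>F. f = (\<lambda>v. vmul (fst M) (fst N) v F)) \<and>
     (\<forall>i<d. \<forall>v\<in>U. f (act i M v) = act i N (f v)) \<and>
     f ` U = vecs (fst N) \<and> {v\<in>U. f v = 0} = V"

lemma subquot_iso_iff: "subquot_iso d M U V N \<longleftrightarrow> (\<exists>f. presents d M U V N f)"
  unfolding subquot_iso_def presents_def zerov_eq_0 by blast

lemma presents_linear:
  assumes "presents d M U V N f"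
  shows "f (v + w) = f v + f w" "f (v - w) = f v - f w" "f (vscale a v) = vscale a (f v)"
    "f 0 = 0" "f (\<Sum>i\<in>S. g i) = (\<Sum>i\<in>S. f (g i))"
  using assms unfolding presents_def
  by (auto simp: vmul_add vmul_diff vmul_scale vmul_zero vmul_sum)

text \<open>Row \<open>i\<close> of \<open>H\<close> is the value under \<open>F'\<close> of a
  chosen preimage of the unit vector \<open>i\<close>; the kernel condition makes the choice
  irrelevant.\<close>

lemma factor_matrix:
  assumes U: "fv.subspace U" and surj: "(\<lambda>v. vmul l m v F) ` U = vecs m"
    and ker: "\<And>v. v \<in> U \<Longrightarrow> vmul l m v F = 0 \<Longrightarrow> vmul l m' v F' = 0"
  shows "\<exists>H. \<forall>v\<in>U. vmul m m' (vmul l m v F) H = vmul l m' v F'"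
proof -
  have "\<exists>w. \<forall>i<m. w i \<in> U \<and> vmul l m (w i) F = unitv i"
  proof (intro choice allI)
    fix i
    show "\<exists>w. i < m \<longrightarrow> w \<in> U \<and> vmul l m w F = unitv i"
      using surj unitv_in_vecs[of i m] by (metis (mono_tags, lifting) imageE)
  qed
  then obtain w where w: "\<And>i. i < m \<Longrightarrow> w i \<in> U" "\<And>i. i < m \<Longrightarrow> vmul l m (w i) F = unitv i"
    by blast
  define H where "H i = vmul l m' (w i) F'" for i
  have "vmul m m' (vmul l m v F) H = vmul l m' v F'" if v: "v \<in> U" for v
  proof -
    define a where "a = vmul l m v F"
    \<comment> \<open>\<open>z\<close> is assembled from the chosen preimages to have the same image
      under \<open>F\<close> as \<open>v\<close>, so \<open>v - z\<close> is killed by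
      \<open>F\<close> and therefore by \<open>F'\<close>.\<close>
    define z where "z = (\<Sum>i<m. vscale (a i) (w i))"
    have zU: "z \<in> U"
      unfolding z_def using w(1) U by (intro fv.subspace_sum fv.subspace_scale) auto
    have "vmul l m z F = (\<Sum>i<m. vscale (a i) (unitv i))"
      by (simp add: z_def vmul_sum vmul_scale w(2))
    also have "\<dots> = vmul l m v F"
      using vecs_expand[of a m] by (simp add: a_def vmul_in_vecs)
    finally have "vmul l m (v - z) F = 0" by (simp add: vmul_diff)
    then have "vmul l m' (v - z) F' = 0" using ker zU v U fv.subspace_diff by blast
    then have "vmul l m' v F' = (\<Sum>i<m. vscale (a i) (H i))"
      by (simp add: vmul_diff z_def vmul_sum vmul_scale H_def)
    also have "\<dots> = vmul m m' a H"
      by (rule ext) (auto simp: sum_apply vscale_apply vmul_def H_def)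
    finally show ?thesis by (simp add: a_def)
  qed
  then show ?thesis by blast
qed

text \<open>Both presentations have kernel \<open>V\<close>, so the second factors through the first
  by an injective map. This makes later notions independent of the module representing the
  subquotient.\<close>

lemma subquotient_unique:
  assumes X: "subquot_iso d M U V X" and Y: "subquot_iso d M U V Y" and U: "submodule d M U"
  shows "subquot_iso d X (vecs (fst X)) {0} Y"
proof -
  obtain f F where f: "presents d M U V X f" "f = (\<lambda>v. vmul (fst M) (fst X) v F)"
    using X by (auto simp: subquot_iso_iff presents_def)
  obtain g K where g: "presents d M U V Y g" "g = (\<lambda>v. vmul (fst M) (fst Y) v K)"
    using Y by (auto simp: subquot_iso_iff presents_def)
  have "\<exists>H. \<forall>v\<in>U. vmul (fst X) (fst Y) (f v) H = g v"
    unfolding f(2) g(2)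
    using f g U by (intro factor_matrix) (auto simp: presents_def submodule_iff)
  then obtain H where H: "\<And>v. v \<in> U \<Longrightarrow> vmul (fst X) (fst Y) (f v) H = g v" by blast
  define h where "h v = vmul (fst X) (fst Y) v H" for v
  have fU: "f ` U = vecs (fst X)" using f by (simp add: presents_def)
  have hf: "h (f v) = g v" if "v \<in> U" for v using H that by (simp add: h_def)
  have "h (act i X x) = act i Y (h x)" if i: "i < d" and x: "x \<in> vecs (fst X)" for i x
  proof -
    obtain v where v: "v \<in> U" "x = f v" using x fU by blast
    have "act i M v \<in> U" using U v i by (simp add: submodule_iff)
    moreover have "f (act i M v) = act i X (f v)" "g (act i M v) = act i Y (g v)"
      using f g v i by (auto simp: presents_def)
    ultimately show ?thesis using v hf by metis
  qed
  moreover have "h ` vecs (fst X) = vecs (fst Y)"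
    using g hf unfolding fU[symmetric] image_image by (simp add: presents_def cong: image_cong)
  moreover have "{x \<in> vecs (fst X). h x = 0} = {0}"
  proof -
    have "x = 0" if x: "x \<in> vecs (fst X)" "h x = 0" for x :: "nat \<Rightarrow> 'a"
    proof -
      obtain v where v: "v \<in> U" "x = f v" using x fU by blast
      then have "g v = 0" using x hf by simp
      then have "v \<in> V" using g v by (auto simp: presents_def)
      then show ?thesis using f v by (auto simp: presents_def)
    qed
    then show ?thesis
      using fv.subspace_0[OF subspace_vecs] by (auto simp: h_def vmul_zero)
  qed
  ultimately have "presents d X (vecs (fst X)) {0} Y h"
    unfolding presents_def h_def by blast
  then show ?thesis by (auto simp: subquot_iso_iff)
qed

text \<open>The action on the quotient is found by factoring \<open>act i\<close> followed by the
  projection through the projection itself, which works because \<open>V\<close> is stable under the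
  action. The module identities descend from \<open>M\<close> along the surjection.\<close>

lemma subquotient_exists:
  assumes M: "is_module d c u M" and U: "submodule d M U" and V: "submodule d M V" and "V \<subseteq> U"
  shows "\<exists>X. is_module d c u X \<and> subquot_iso d M U V X"
proof -
  define n where "n = fst M"
  obtain m F where surj: "(\<lambda>v. vmul n m v F) ` U = vecs m" and ker: "{v\<in>U. vmul n m v F = 0} = V"
    using quotient_matrix_exists[of V U n] assms by (auto simp: submodule_iff n_def)
  have "\<exists>A. \<forall>v\<in>U. vmul m m (vmul n m v F) A = vmul n m (act i M v) F" if i: "i < d" for i
  proof -
    define F' where "F' = (\<lambda>p q. \<Sum>r<n. snd M i p r * F r q)"
    have F': "vmul n m v F' = vmul n m (act i M v) F" for v
      by (simp add: F'_def act_def n_def vmul_vmul)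
    have "vmul n m v F' = 0" if "v \<in> U" "vmul n m v F = 0" for v
    proof -
      have "v \<in> V" using that ker by blast
      then have "act i M v \<in> V" using V i by (simp add: submodule_iff)
      then show ?thesis using ker F' by auto
    qed
    then have "\<exists>H. \<forall>v\<in>U. vmul m m (vmul n m v F) H = vmul n m v F'"
      using U surj by (intro factor_matrix) (auto simp: submodule_iff)
    then show ?thesis by (simp add: F')
  qed
  then obtain A where A: "\<And>i v. i < d \<Longrightarrow> v \<in> U \<Longrightarrow> vmul m m (vmul n m v F) (A i) = vmul n m (act i M v) F"
    by metis
  define f where "f v = vmul n m v F" for v
  define X where "X = (m, A)"
  have act_f: "act i X (f v) = f (act i M v)" if "i < d" "v \<in> U" for i v
    using A that by (simp add: act_def X_def f_def)
  have "presents d M U V X f"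
    unfolding presents_def using act_f surj ker unfolding f_def n_def X_def by auto
  note lin = presents_linear[OF this]
  have actU: "act i M v \<in> U" if "i < d" "v \<in> U" for i v
    using U that by (simp add: submodule_iff)
  have Uv: "U \<subseteq> vecs (fst M)" using U by (simp add: submodule_iff)
  have "is_module d c u X"
    unfolding is_module_iff
  proof (intro conjI allI impI ballI)
    fix i j and x :: "nat \<Rightarrow> 'a" assume ij: "i < d" "j < d" and "x \<in> vecs (fst X)"
    then obtain v where v: "v \<in> U" "x = f v" using surj by (auto simp: X_def f_def)
    have "act j X (act i X x) = f (act j M (act i M v))"
      using v ij by (simp add: act_f actU)
    also have "act j M (act i M v) = (\<Sum>l<d. vscale (c i j l) (act l M v))"
      using M Uv v ij unfolding is_module_iff by blast
    also have "f \<dots> = (\<Sum>l<d. vscale (c i j l) (act l X x))"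
      using v by (simp add: lin act_f)
    finally show "act j X (act i X x) = (\<Sum>l<d. vscale (c i j l) (act l X x))" .
  next
    fix x :: "nat \<Rightarrow> 'a" assume "x \<in> vecs (fst X)"
    then obtain v where v: "v \<in> U" "x = f v" using surj by (auto simp: X_def f_def)
    have "(\<Sum>i<d. vscale (u i) (act i X x)) = f (\<Sum>i<d. vscale (u i) (act i M v))"
      using v by (simp add: lin act_f)
    also have "(\<Sum>i<d. vscale (u i) (act i M v)) = v"
      using M Uv v unfolding is_module_iff by blast
    finally show "(\<Sum>i<d. vscale (u i) (act i X x)) = x" using v by simp
  qed
  then show ?thesis using \<open>presents d M U V X f\<close> subquot_iso_iff by blast
qed

section \<open>The correspondence and isomorphism theorems\<close>

lemma presents_preimage:
  assumes f: "presents d M U V X f" and g: "presents d X W W' Y g" and W: "W \<subseteq> vecs (fst X)"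
  shows "presents d M {v\<in>U. f v \<in> W} {v\<in>U. f v \<in> W'} Y (\<lambda>v. g (f v))"
proof -
  obtain F where F: "f = (\<lambda>v. vmul (fst M) (fst X) v F)" using f by (auto simp: presents_def)
  obtain H where H: "g = (\<lambda>v. vmul (fst X) (fst Y) v H)" using g by (auto simp: presents_def)
  have "\<exists>K. (\<lambda>v. g (f v)) = (\<lambda>v. vmul (fst M) (fst Y) v K)"
    unfolding F H vmul_vmul by blast
  moreover have "f ` {v\<in>U. f v \<in> W} = W" using f W by (fastforce simp: presents_def)
  then have "(\<lambda>v. g (f v)) ` {v\<in>U. f v \<in> W} = vecs (fst Y)"
    using g unfolding presents_def by (metis image_image)
  ultimately show ?thesis using f g unfolding presents_def by auto
qed

lemma submodule_preimage:
  assumes f: "presents d M U V X f" and U: "submodule d M U" and W: "submodule d X W"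
  shows "submodule d M {v\<in>U. f v \<in> W}"
proof -
  have "f (act i M v) = act i X (f v)" if "i < d" "v \<in> U" for i v
    using f that by (simp add: presents_def)
  then show ?thesis
    using U W unfolding submodule_iff fv.subspace_def
    by (simp add: presents_linear[OF f] subset_iff)
qed

lemma submodule_image:
  assumes f: "presents d M U V X f" and A: "submodule d M A" "A \<subseteq> U"
  shows "submodule d X (f ` A)"
proof -
  have "act i X (f v) \<in> f ` A" if "i < d" "v \<in> A" for i v
  proof -
    have "f (act i M v) = act i X (f v)" using f A that by (auto simp: presents_def)
    then show ?thesis using A that unfolding submodule_iff by (metis image_eqI)
  qed
  moreover have "fv.subspace (f ` A)"
  proof (rule fv.subspaceI)
    show "0 \<in> f ` A"
      using A presents_linear(4)[OF f] fv.subspace_0 unfolding submodule_iff by (metis image_eqI)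
    show "x + y \<in> f ` A" if xy: "x \<in> f ` A" "y \<in> f ` A" for x y
    proof -
      obtain v w where vw: "v \<in> A" "w \<in> A" "x = f v" "y = f w" using xy by blast
      have "v + w \<in> A" using A vw fv.subspace_add unfolding submodule_iff by blast
      then show ?thesis using vw presents_linear(1)[OF f] by (metis image_eqI)
    qed
    show "vscale a x \<in> f ` A" if x: "x \<in> f ` A" for a x
    proof -
      obtain v where v: "v \<in> A" "x = f v" using x by blast
      have "vscale a v \<in> A" using A v fv.subspace_scale unfolding submodule_iff by blast
      then show ?thesis using v presents_linear(3)[OF f] by (metis image_eqI)
    qed
  qed
  ultimately show ?thesis using f A unfolding submodule_iff presents_def by blast
qed

text \<open>Vectors of \<open>U\<close> with equal images differ by an element of the kernel
  \<open>V\<close>, which is contained in \<open>A\<close>.\<close>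

lemma preimage_image:
  assumes f: "presents d M U V X f" and U: "submodule d M U"
    and A: "submodule d M A" "A \<subseteq> U" "V \<subseteq> A"
  shows "{v\<in>U. f v \<in> f ` A} = A"
proof -
  have "v \<in> A" if v: "v \<in> U" "a \<in> A" "f v = f a" for v a
  proof -
    have "f (v - a) = 0" using v by (simp add: presents_linear[OF f])
    moreover have "v - a \<in> U" using U A(2) v fv.subspace_diff[of U v a] by (auto simp: submodule_iff)
    ultimately have "v - a \<in> V" using f unfolding presents_def by blast
    then have "(v - a) + a \<in> A" using A v fv.subspace_add unfolding submodule_iff by blast
    then show ?thesis by simp
  qed
  then show ?thesis using A by blast
qed

lemma image_preimage:
  assumes f: "presents d M U V X f" and W: "W \<subseteq> vecs (fst X)"
  shows "f ` {v\<in>U. f v \<in> W} = W"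
  using f W by (fastforce simp: presents_def)

lemma subquot_iso_trans:
  assumes "subquot_iso d M U V X" "subquot_iso d X (vecs (fst X)) {0} Y"
  shows "subquot_iso d M U V Y"
proof -
  obtain f g where fg: "presents d M U V X f" "presents d X (vecs (fst X)) {0} Y g"
    using assms by (auto simp: subquot_iso_iff)
  have "{v\<in>U. f v \<in> vecs (fst X)} = U" "{v\<in>U. f v \<in> {0}} = V"
    using fg(1) by (auto simp: presents_def)
  then have "presents d M U V Y (\<lambda>v. g (f v))" using presents_preimage[OF fg] by simp
  then show ?thesis unfolding subquot_iso_iff by blast
qed

lemma subquot_iso_correspondence:
  assumes f: "presents d M U V X f" and U: "submodule d M U" and X: "is_module d c u X"
    and W: "submodule d X W" "submodule d X W'" "W' \<subseteq> W"
  shows "subquot_iso d X W W' Y \<longleftrightarrow> subquot_iso d M {v\<in>U. f v \<in> W} {v\<in>U. f v \<in> W'} Y"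
proof
  have Wv: "W \<subseteq> vecs (fst X)" using W by (simp add: submodule_iff)
  show "subquot_iso d M {v\<in>U. f v \<in> W} {v\<in>U. f v \<in> W'} Y" if "subquot_iso d X W W' Y"
    using that presents_preimage[OF f _ Wv] unfolding subquot_iso_iff by blast
  assume Y: "subquot_iso d M {v\<in>U. f v \<in> W} {v\<in>U. f v \<in> W'} Y"
  \<comment> \<open>No map out of \<open>X\<close> has to be built for the converse: a model
    \<open>Y'\<close> of the subquotient of \<open>X\<close> is also one of the preimages in
    \<open>M\<close>, and uniqueness there makes it isomorphic to \<open>Y\<close>.\<close>
  obtain Y' where Y': "subquot_iso d X W W' Y'" using subquotient_exists[OF X W] by blast
  then have "subquot_iso d M {v\<in>U. f v \<in> W} {v\<in>U. f v \<in> W'} Y'"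
    using presents_preimage[OF f _ Wv] unfolding subquot_iso_iff by blast
  then show "subquot_iso d X W W' Y"
    using subquotient_unique[OF _ Y submodule_preimage[OF f U W(1)]] subquot_iso_trans[OF Y']
    by blast
qed

text \<open>A presentation of \<open>vsum A B\<close> modulo \<open>B\<close> keeps its image when
  restricted to \<open>A\<close>, and its kernel there is \<open>A \<inter> B\<close>. The other
  direction follows from uniqueness of subquotients.\<close>

lemma subquot_iso_second_isomorphism:
  assumes M: "is_module d c u M" and A: "submodule d M A" and B: "submodule d M B"
  shows "subquot_iso d M A (A \<inter> B) X \<longleftrightarrow> subquot_iso d M (vsum A B) B X"
proof
  have "0 \<in> A" "0 \<in> B" using A B fv.subspace_0 unfolding submodule_iff by blast+
  then have sub: "A \<subseteq> vsum A B" "B \<subseteq> vsum A B" by (simp_all add: subset_vsum)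
  have restrict: "subquot_iso d M A (A \<inter> B) Y" if Y: "subquot_iso d M (vsum A B) B Y" for Y
  proof -
    obtain f where f: "presents d M (vsum A B) B Y f" using Y by (auto simp: subquot_iso_iff)
    have "f (a + b) = f a" if "b \<in> B" for a b
      using f that by (auto simp: presents_linear[OF f] presents_def)
    then have "f ` vsum A B \<subseteq> f ` A" unfolding vsum_def by fastforce
    then have "presents d M A (A \<inter> B) Y f" using f sub unfolding presents_def by blast
    then show ?thesis by (auto simp: subquot_iso_iff)
  qed
  show "subquot_iso d M A (A \<inter> B) X" if "subquot_iso d M (vsum A B) B X"
    by (rule restrict[OF that])
  assume X: "subquot_iso d M A (A \<inter> B) X"
  obtain Y where Y: "subquot_iso d M (vsum A B) B Y"
    using subquotient_exists[OF M submodule_vsum[OF A B] B sub(2)] by blast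
  show "subquot_iso d M (vsum A B) B X"
    using subquot_iso_trans[OF Y subquotient_unique[OF restrict[OF Y] X A]] .
qed

lemma subquot_iso_refl: "subquot_iso d M (vecs (fst M)) {0} M"
proof -
  define h where "h v = vmul (fst M) (fst M) v (\<lambda>p q. if p = q then 1 else 0)" for v :: "nat \<Rightarrow> 'a"
  have h: "h v = v" if "v \<in> vecs (fst M)" for v using that by (simp add: h_def vmul_identity)
  have "presents d M (vecs (fst M)) {0} M h"
    unfolding presents_def
  proof (intro conjI allI impI ballI)
    show "\<exists>F. h = (\<lambda>v. vmul (fst M) (fst M) v F)" unfolding h_def by blast
    show "h ` vecs (fst M) = vecs (fst M)" using h by simp
    show "{v \<in> vecs (fst M). h v = 0} = {0}"
      using h fv.subspace_0[OF subspace_vecs] by auto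
  qed (simp add: h act_in_vecs)
  then show ?thesis by (auto simp: subquot_iso_iff)
qed

lemma subquot_iso_zero: 
  assumes "submodule d M U"
  shows "subquot_iso d M U U (0, A)"
proof -
  have "vecs 0 = {0}" by (auto simp: vecs_def zero_fun_def)
  moreover have "(\<lambda>_. 0) = (\<lambda>v. vmul (fst M) 0 v F)" for F :: "nat \<Rightarrow> nat \<Rightarrow> 'a"
    by (simp add: vmul_def zero_fun_def)
  moreover have "0 \<in> U" using assms fv.subspace_0 unfolding submodule_iff by blast
  ultimately have "presents d M U U (0, A) (\<lambda>_. 0)"
    unfolding presents_def by (auto simp: act_zero)
  then show ?thesis by (auto simp: subquot_iso_iff)
qed

lemma is_module_zero: "is_module d c u (0, A)"
  by (simp add: is_module_def)

lemma vsum_modular: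
  assumes C: "fv.subspace C" and "B \<subseteq> C"
  shows "vsum A B \<inter> C = vsum (A \<inter> C) B"
proof (intro equalityI subsetI)
  fix x assume x: "x \<in> vsum A B \<inter> C"
  then obtain a b where ab: "a \<in> A" "b \<in> B" "x = a + b" unfolding vsum_def by blast
  have "x - b \<in> C" using C fv.subspace_diff x ab assms(2) by blast
  then have "a \<in> C" using ab by simp
  then show "x \<in> vsum (A \<inter> C) B" using ab unfolding vsum_def by blast
next
  fix x assume "x \<in> vsum (A \<inter> C) B"
  then obtain a b where ab: "a \<in> A" "a \<in> C" "b \<in> B" "x = a + b" unfolding vsum_def by blast
  then have "x \<in> C" using C fv.subspace_add assms(2) by blast
  then show "x \<in> vsum A B \<inter> C" using ab unfolding vsum_def by blast
qed

lemma vsum_least: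
  assumes C: "fv.subspace C" and "A \<subseteq> C" "B \<subseteq> C"
  shows "vsum A B \<subseteq> C"
  using assms fv.subspace_add unfolding vsum_def by blast

lemma submodule_0: "submodule d M U \<Longrightarrow> 0 \<in> U"
  using fv.subspace_0 unfolding submodule_iff by blast

lemma vecs_0: "vecs 0 = {0}"
  by (auto simp: vecs_def zero_fun_def)

lemma presents_zero_dim:
  assumes f: "presents d M U V X f" and "fst X = 0"
  shows "U = V"
proof -
  have "f ` U \<subseteq> {0}" using f assms(2) by (simp add: presents_def vecs_0)
  then show ?thesis using f by (auto simp: presents_def)
qed

lemma presents_image_kernel:
  assumes f: "presents d M U V X f" and V: "submodule d M V"
  shows "f ` V = {0}"
proof -
  have "f v = 0" if "v \<in> V" for v using f that by (auto simp: presents_def)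
  then show ?thesis using submodule_0[OF V] by force
qed

text \<open>Third isomorphism theorem: inside a model \<open>X\<close> of the quotient of
  \<open>U\<close> by \<open>W\<close>, the image of \<open>V\<close> represents the quotient of
  \<open>V\<close> by \<open>W\<close>, and factoring it out leaves the quotient of \<open>U\<close>
  by \<open>V\<close>.\<close>

lemma presents_nested:
  assumes f: "presents d M U W X f" and X: "is_module d c u X"
    and U: "submodule d M U" and V: "submodule d M V" and sub: "W \<subseteq> V" "V \<subseteq> U"
  shows "subquot_iso d X (f ` V) {0} Y \<longleftrightarrow> subquot_iso d M V W Y"
    and "subquot_iso d X (vecs (fst X)) (f ` V) Y \<longleftrightarrow> subquot_iso d M U V Y"
proof -
  note fV = submodule_image[OF f V sub(2)]
  have pre: "{v\<in>U. f v \<in> f ` V} = V" "{v\<in>U. f v \<in> {0}} = W" "{v\<in>U. f v \<in> vecs (fst X)} = U"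
    using preimage_image[OF f U V sub(2,1)] f by (auto simp: presents_def)
  have "{0} \<subseteq> f ` V" "f ` V \<subseteq> vecs (fst X)"
    using submodule_0[OF fV] fV by (auto simp: submodule_iff)
  then show "subquot_iso d X (f ` V) {0} Y \<longleftrightarrow> subquot_iso d M V W Y"
    and "subquot_iso d X (vecs (fst X)) (f ` V) Y \<longleftrightarrow> subquot_iso d M U V Y"
    using subquot_iso_correspondence[OF f U X fV submodule_zero, of Y]
      subquot_iso_correspondence[OF f U X submodule_vecs fV, of Y] unfolding pre by blast+
qed

text \<open>The zero module is an extension of itself by itself, so its value is twice
  itself.\<close>

lemma additive_zero_module:
  assumes "additive d c u \<phi>"
  shows "\<phi> (0, A) = 0"
proof -
  have "\<phi> (0, A) = \<phi> (0, A) + \<phi> (0, A)"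
    using assms subquot_iso_zero[OF submodule_zero[of d "(0, A)"], of A] is_module_zero submodule_zero
    unfolding additive_def zerov_eq_0 by (metis fst_conv vecs_0)
  then show ?thesis by simp
qed

lemma additive_iso:
  assumes "additive d c u \<phi>" "is_module d c u N" "is_module d c u Q"
    "subquot_iso d N (vecs (fst N)) {0} Q"
  shows "\<phi> N = \<phi> Q"
proof -
  have "\<phi> N = \<phi> (0, \<lambda>_ _ _. 0) + \<phi> Q"
    using assms subquot_iso_zero[OF submodule_zero[of d N]] is_module_zero submodule_zero
    unfolding additive_def zerov_eq_0 by metis
  then show ?thesis using additive_zero_module[OF assms(1)] by simp
qed

section \<open>Stability in modular lattices\<close>

text \<open>The time \<open>s\<close> is the supremum of the times up to \<open>t0\<close> at which
  some member of \<open>F\<close> is nonpositive. These times form a closed set, as \<open>F\<close>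
  is a finite set of continuous functions.\<close>

lemma last_nonpositive_time:
  fixes F :: "(real \<Rightarrow> real) set"
  assumes fin: "finite F" and cont: "\<And>f. f \<in> F \<Longrightarrow> continuous_on UNIV f"
    and pos: "\<And>f. f \<in> F \<Longrightarrow> f t0 > 0" and neg: "f0 \<in> F" "t1 \<le> t0" "f0 t1 \<le> 0"
  shows "\<exists>s<t0. (\<forall>f\<in>F. f s \<ge> 0) \<and> (\<exists>f\<in>F. f s = 0)"
proof -
  define K where "K = {t. t \<le> t0 \<and> (\<exists>f\<in>F. f t \<le> 0)}"
  have K: "K = (\<Union>f\<in>F. {t. t \<le> t0} \<inter> {t. f t \<le> 0})" by (auto simp: K_def)
  have "closed K"
    unfolding K using fin cont
    by (intro closed_UN closed_Int closed_Collect_le ballI) (auto intro!: continuous_intros)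
  moreover have "K \<noteq> {}" using neg by (auto simp: K_def)
  moreover have bdd: "bdd_above K" by (auto simp: K_def bdd_above_def)
  ultimately have s: "Sup K \<in> K" by (intro closed_contains_Sup)
  have "t0 \<notin> K" using pos by (force simp: K_def)
  then have lt: "Sup K < t0" using s by (cases "Sup K = t0") (auto simp: K_def)
  \<comment> \<open>A function negative at \<open>Sup K\<close> is positive at \<open>t0\<close>,
    hence has a zero strictly in between, which would be a later element of
    \<open>K\<close>.\<close>
  have nonneg: "f (Sup K) \<ge> 0" if f: "f \<in> F" for f
  proof (rule ccontr)
    assume "\<not> f (Sup K) \<ge> 0"
    then obtain x where x: "Sup K \<le> x" "x \<le> t0" "f x = 0"
      using IVT'[of f "Sup K" 0 t0] pos[OF f] lt continuous_on_subset[OF cont[OF f]] by auto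
    then have "x \<in> K" using f unfolding K_def by (auto intro!: bexI[of _ f])
    then have "x = Sup K" using cSup_upper[OF _ bdd] x by force
    then show False using x \<open>\<not> f (Sup K) \<ge> 0\<close> by simp
  qed
  then have "\<exists>f\<in>F. f (Sup K) = 0" using s by (force simp: K_def)
  then show ?thesis using lt nonneg by blast
qed

text \<open>The intended reading is that \<open>gq U V\<close> says that \<open>U/V\<close> lies in the torsion class and that
  \<open>h t U V\<close> is the value of \<open>\<theta>\<^sub>t\<close> at \<open>U/V\<close>; below, \<open>st U V A\<close> says that \<open>A/V\<close> is a strict subobject
  of \<open>U/V\<close>, \<open>semistable\<close> that \<open>U/V\<close> lies in \<open>W(\<theta>\<^sub>t)\<close>, and \<open>stable\<close> that it lies in \<open>W\<^sub>0(\<theta>\<^sub>t)\<close>.\<close>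

locale stability_lattice =
  fixes L :: "'a set set" and join :: "'a set \<Rightarrow> 'a set \<Rightarrow> 'a set" and Z :: "'a set"
    and dm :: "'a set \<Rightarrow> nat" and gq :: "'a set \<Rightarrow> 'a set \<Rightarrow> bool"
    and h :: "real \<Rightarrow> 'a set \<Rightarrow> 'a set \<Rightarrow> real"
  assumes Int_L: "A \<in> L \<Longrightarrow> B \<in> L \<Longrightarrow> A \<inter> B \<in> L"
    and join_L: "A \<in> L \<Longrightarrow> B \<in> L \<Longrightarrow> join A B \<in> L"
    and join_upper: "A \<in> L \<Longrightarrow> B \<in> L \<Longrightarrow> A \<subseteq> join A B \<and> B \<subseteq> join A B"
    and join_least: "A \<in> L \<Longrightarrow> B \<in> L \<Longrightarrow> C \<in> L \<Longrightarrow> A \<subseteq> C \<Longrightarrow> B \<subseteq> C \<Longrightarrow> join A B \<subseteq> C"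
    and modular: "A \<in> L \<Longrightarrow> B \<in> L \<Longrightarrow> C \<in> L \<Longrightarrow> B \<subseteq> C \<Longrightarrow> join A B \<inter> C = join (A \<inter> C) B"
    and Z_L: "Z \<in> L" and Z_least: "A \<in> L \<Longrightarrow> Z \<subseteq> A"
    and dm_strict_mono: "A \<in> L \<Longrightarrow> B \<in> L \<Longrightarrow> A \<subset> B \<Longrightarrow> dm A < dm B"
    and gq_refl: "A \<in> L \<Longrightarrow> gq A A"
    and gq_quotient: "U \<in> L \<Longrightarrow> V \<in> L \<Longrightarrow> W \<in> L \<Longrightarrow> W \<subseteq> V \<Longrightarrow> V \<subseteq> U \<Longrightarrow> gq U W \<Longrightarrow> gq U V"
    and gq_extension: "U \<in> L \<Longrightarrow> V \<in> L \<Longrightarrow> W \<in> L \<Longrightarrow> W \<subseteq> V \<Longrightarrow> V \<subseteq> U \<Longrightarrow> gq U V \<Longrightarrow> gq V W \<Longrightarrow> gq U W"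
    and gq_iso: "A \<in> L \<Longrightarrow> B \<in> L \<Longrightarrow> gq A (A \<inter> B) \<longleftrightarrow> gq (join A B) B"
    and h_add: "U \<in> L \<Longrightarrow> V \<in> L \<Longrightarrow> W \<in> L \<Longrightarrow> W \<subseteq> V \<Longrightarrow> V \<subseteq> U \<Longrightarrow> h t U W = h t U V + h t V W"
    and h_iso: "A \<in> L \<Longrightarrow> B \<in> L \<Longrightarrow> h t A (A \<inter> B) = h t (join A B) B"
    and h_continuous: "U \<in> L \<Longrightarrow> V \<in> L \<Longrightarrow> V \<subseteq> U \<Longrightarrow> continuous_on UNIV (\<lambda>t. h t U V)"
    and h_pos: "\<exists>T. \<forall>t>T. \<forall>U\<in>L. \<forall>V\<in>L. V \<subset> U \<longrightarrow> gq U V \<longrightarrow> h t U V > 0"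
    and h_neg: "\<exists>T. \<forall>t<T. \<forall>U\<in>L. \<forall>V\<in>L. V \<subset> U \<longrightarrow> gq U V \<longrightarrow> h t U V < 0"
begin

section \<open>Strict subobjects and semistable quotients\<close>

definition st :: "'a set \<Rightarrow> 'a set \<Rightarrow> 'a set \<Rightarrow> bool" where
  "st U V A \<longleftrightarrow> A \<in> L \<and> V \<subseteq> A \<and> A \<subseteq> U \<and> gq A V \<and>
     (\<forall>C\<in>L. V \<subseteq> C \<longrightarrow> C \<subseteq> U \<longrightarrow> gq C V \<longrightarrow> gq (A \<inter> C) V)"

definition semistable :: "real \<Rightarrow> 'a set \<Rightarrow> 'a set \<Rightarrow> bool" where
  "semistable t U V \<longleftrightarrow> gq U V \<and> h t U V = 0 \<and> (\<forall>A. st U V A \<longrightarrow> h t A V \<le> 0)"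

definition stable :: "real \<Rightarrow> 'a set \<Rightarrow> 'a set \<Rightarrow> bool" where
  "stable t U V \<longleftrightarrow> semistable t U V \<and> U \<noteq> V \<and>
     \<not> (\<exists>A. st U V A \<and> A \<noteq> V \<and> A \<noteq> U \<and> semistable t A V)"

lemma st_bot: "V \<in> L \<Longrightarrow> V \<subseteq> U \<Longrightarrow> st U V V"
  unfolding st_def using gq_refl by (auto simp: Int_absorb2)

lemma st_top: "U \<in> L \<Longrightarrow> V \<subseteq> U \<Longrightarrow> gq U V \<Longrightarrow> st U V U"
  unfolding st_def by (auto simp: Int_absorb1)

text \<open>A test submodule \<open>C\<close> of \<open>U\<close> is first cut down to
  \<open>B \<inter> C\<close>, which strictness of \<open>B\<close> turns into a valid test for
  \<open>A\<close> inside \<open>B\<close>.\<close>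

lemma st_trans:
  assumes "st U V B" "st B V A"
  shows "st U V A"
  unfolding st_def
proof (intro conjI ballI impI)
  fix C assume C: "C \<in> L" "V \<subseteq> C" "C \<subseteq> U" "gq C V"
  have B: "gq (B \<inter> C) V" using assms(1) C by (simp add: st_def)
  have "B \<in> L" "V \<subseteq> B" using assms(1) by (auto simp: st_def)
  then have "B \<inter> C \<in> L" "V \<subseteq> B \<inter> C" using Int_L C by auto
  then have "gq (A \<inter> (B \<inter> C)) V" using assms(2) B by (simp add: st_def)
  moreover have "A \<inter> (B \<inter> C) = A \<inter> C" using assms unfolding st_def by blast
  ultimately show "gq (A \<inter> C) V" by simp
qed (use assms in \<open>auto simp: st_def\<close>)

text \<open>For \<open>V \<subseteq> A \<subseteq> B\<close>, the intersection \<open>B \<inter> C\<close> is an extension of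
  \<open>(B \<inter> C)/(A \<inter> C) \<cong> B \<inter> (C + A) / A\<close> by \<open>A \<inter> C\<close>.\<close>

lemma st_preimage:
  assumes U: "U \<in> L" and V: "V \<in> L" and A: "st U V A" and B: "st U A B"
  shows "st U V B"
  unfolding st_def
proof (intro conjI ballI impI)
  have L: "A \<in> L" "B \<in> L" and sub: "V \<subseteq> A" "A \<subseteq> B" "B \<subseteq> U" using A B by (auto simp: st_def)
  show "gq B V" using gq_extension[of B A V] A B V L sub by (auto simp: st_def)
  fix C assume C: "C \<in> L" "V \<subseteq> C" "C \<subseteq> U" "gq C V"
  note CL = Int_L[OF C(1) L(1)] Int_L[OF C(1) L(2)]
  \<comment> \<open>The quotient of \<open>C\<close> by \<open>C \<inter> A\<close> is a quotient of
    \<open>C\<close> by \<open>V\<close> and isomorphic to that of \<open>join C A\<close> by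
    \<open>A\<close>; so \<open>join C A\<close> is a valid test for strictness of \<open>B\<close>
    above \<open>A\<close>.\<close>
  have "gq C (C \<inter> A)" using gq_quotient[of C "C \<inter> A" V] C L CL V sub by auto
  then have "gq (join C A) A" using gq_iso C L by simp
  moreover have "join C A \<subseteq> U" using join_least[OF C(1) L(1) U C(3)] sub by blast
  ultimately have "gq (B \<inter> join C A) A"
    using B join_L[OF C(1) L(1)] join_upper[OF C(1) L(1)] unfolding st_def by blast
  also have "B \<inter> join C A = join (C \<inter> B) A"
    using modular[OF C(1) L sub(2)] by (simp add: Int_commute)
  finally have "gq (C \<inter> B) (C \<inter> B \<inter> A)" using gq_iso[OF CL(2) L(1)] by simp
  moreover have "C \<inter> B \<inter> A = C \<inter> A" using sub by blast
  moreover have "gq (C \<inter> A) V" using A C by (auto simp: st_def Int_commute)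
  ultimately show "gq (B \<inter> C) V"
    using gq_extension[of "C \<inter> B" "C \<inter> A" V] CL V C sub by (auto simp: Int_commute)
qed (use A B in \<open>auto simp: st_def\<close>)

text \<open>Since \<open>h t A V = 0\<close>, replacing the bottom \<open>V\<close> by
  \<open>A\<close> changes no value, and each \<open>B\<close> strict above \<open>A\<close> is
  strict above \<open>V\<close> by \<open>st_preimage\<close>.\<close>

lemma semistable_quotient:
  assumes L: "U \<in> L" "V \<in> L" and A: "st U V A" "semistable t A V" and U: "semistable t U V"
  shows "semistable t U A"
  unfolding semistable_def
proof (intro conjI allI impI)
  have AL: "A \<in> L" "V \<subseteq> A" "A \<subseteq> U" using A by (auto simp: st_def)
  show "gq U A" using gq_quotient[of U A V] U L AL by (auto simp: semistable_def)
  show "h t U A = 0" using h_add[of U A V t] L AL U A by (auto simp: semistable_def)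
  fix B assume B: "st U A B"
  have "h t B V \<le> 0" using U st_preimage[OF L A(1) B] by (simp add: semistable_def)
  moreover have "h t B V = h t B A + h t A V"
    using B AL L by (intro h_add) (auto simp: st_def)
  ultimately show "h t B A \<le> 0" using A by (simp add: semistable_def)
qed

text \<open>Induction on \<open>dm U - dm V\<close> with \<open>U\<close> fixed: the bottom is
  raised from \<open>V\<close> to \<open>A\<close>, and what remains above \<open>A\<close> is
  semistable by \<open>semistable_quotient\<close>.\<close>

lemma stable_filtration:
  assumes "U \<in> L" "V \<in> L" "V \<subseteq> U" "semistable t U V"
  shows "\<exists>(r::nat) Ns. Ns 0 = V \<and> Ns r = U \<and> (\<forall>j\<le>r. st U V (Ns j)) \<and>
    (\<forall>j\<in>{1..r}. Ns (j - 1) \<subseteq> Ns j \<and> stable t (Ns j) (Ns (j - 1)))"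
  using assms(2-)
proof (induction "dm U - dm V" arbitrary: V rule: less_induct)
  case (less V)
  show ?case
  proof (cases "V = U")
    case True
    then show ?thesis
      using assms(1) less.prems st_bot by (intro exI[of _ 0] exI[of _ "\<lambda>_. V"]) auto
  next
    case False
    have top: "st U V U" using st_top assms(1) less.prems by (auto simp: semistable_def)
    \<comment> \<open>The set of candidates contains \<open>U\<close>, so one of least
      \<open>dm\<close> exists.\<close>
    obtain A where A: "st U V A" "A \<noteq> V" "semistable t A V"
      and min: "\<And>B. st U V B \<Longrightarrow> B \<noteq> V \<Longrightarrow> semistable t B V \<Longrightarrow> dm A \<le> dm B"
      using ex_has_least_nat[of "\<lambda>A. st U V A \<and> A \<noteq> V \<and> semistable t A V" U dm]
        top False less.prems by auto
    have AL: "A \<in> L" "V \<subseteq> A" "A \<subseteq> U" using A by (auto simp: st_def)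
    have stab: "stable t A V"
      unfolding stable_def
    proof (intro conjI notI)
      \<comment> \<open>By \<open>st_trans\<close> such a \<open>B\<close> would be a candidate
        strictly smaller than the minimal \<open>A\<close>.\<close>
      assume "\<exists>B. st A V B \<and> B \<noteq> V \<and> B \<noteq> A \<and> semistable t B V"
      then obtain B where B: "st A V B" "B \<noteq> V" "B \<noteq> A" "semistable t B V" by blast
      have "dm A \<le> dm B" using min st_trans[OF A(1) B(1)] B by blast
      moreover have "dm B < dm A" using B AL by (intro dm_strict_mono) (auto simp: st_def)
      ultimately show False by simp
    qed (use A in auto)
    have "dm V < dm A" using dm_strict_mono AL A less.prems by blast
    moreover have "dm A \<le> dm U"
      using dm_strict_mono[of A U] AL assms(1) by (cases "A = U") (auto simp: psubset_eq)
    ultimately have "dm U - dm A < dm U - dm V" by simp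
    then obtain r :: nat and Ns where N: "Ns 0 = A" "Ns r = U" "\<And>j. j \<le> r \<Longrightarrow> st U A (Ns j)"
      "\<And>j. j \<in> {1..r} \<Longrightarrow> Ns (j - 1) \<subseteq> Ns j \<and> stable t (Ns j) (Ns (j - 1))"
      using less.hyps[of A] AL semistable_quotient[OF assms(1) less.prems(1) A(1,3) less.prems(3)]
      by blast
    \<comment> \<open>\<open>case_nat V Ns\<close> puts \<open>V\<close> in front of the chain that
      starts at \<open>A\<close>, shifting its indices by one.\<close>
    show ?thesis
    proof (intro exI[of _ "Suc r"] exI[of _ "case_nat V Ns"] conjI allI impI ballI)
      fix j assume j: "j \<le> Suc r"
      show "st U V (case_nat V Ns j)"
      proof (cases j)
        case 0
        then show ?thesis using st_bot less.prems by simp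
      next
        case (Suc i)
        then show ?thesis using st_preimage[OF assms(1) less.prems(1) A(1) N(3)] j by simp
      qed
    next
      fix j assume j: "j \<in> {1..Suc r}"
      then obtain i where i: "j = Suc i" "i \<le> r" by (cases j) auto
      have "case_nat V Ns (j - 1) \<subseteq> case_nat V Ns j \<and>
        stable t (case_nat V Ns j) (case_nat V Ns (j - 1))"
        using i N(1) N(4)[of i] AL stab by (cases i) auto
      then show "case_nat V Ns (j - 1) \<subseteq> case_nat V Ns j"
        "stable t (case_nat V Ns j) (case_nat V Ns (j - 1))" by auto
    qed (use N in auto)
  qed
qed

text \<open>With \<open>U'\<close> a maximal proper submodule of \<open>U\<close>, every \<open>B \<subseteq> U\<close> not contained in \<open>U'\<close> satisfies
  \<open>B + U' = U\<close>, so that \<open>h B = h (B \<inter> U') + h U - h U'\<close>.\<close>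

lemma finite_values:
  assumes "U \<in> L"
  shows "finite {(\<lambda>t. h t B Z) | B. B \<in> L \<and> B \<subseteq> U}"
  using assms
proof (induction "dm U" arbitrary: U rule: less_induct)
  case (less U)
  define H where "H B = (\<lambda>t. h t B Z)" for B
  show ?case
  proof (cases "U = Z")
    case True
    then have "{(\<lambda>t. h t B Z) | B. B \<in> L \<and> B \<subseteq> U} \<subseteq> {H Z}"
      using Z_least by (auto simp: H_def dest!: Z_least)
    then show ?thesis using finite_subset by blast
  next
    case False
    \<comment> \<open>\<open>Z\<close> is a proper submodule and \<open>dm\<close> is bounded by
      \<open>dm U\<close>, so a proper submodule of greatest \<open>dm\<close> exists; anything
      strictly larger inside \<open>U\<close> must be \<open>U\<close>.\<close>
    have "\<exists>A. (A \<in> L \<and> A \<subset> U) \<and> (\<forall>B. B \<in> L \<and> B \<subset> U \<longrightarrow> dm B \<le> dm A)"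
      using False Z_L Z_least less.prems dm_strict_mono
      by (intro ex_has_greatest_nat[of _ Z _ "dm U"]) (auto simp: psubset_eq less_imp_le)
    then obtain U' where U': "U' \<in> L" "U' \<subset> U" and max: "\<And>B. B \<in> L \<Longrightarrow> B \<subset> U \<Longrightarrow> dm B \<le> dm U'"
      by blast
    define E where "E = {(\<lambda>t. h t B Z) | B. B \<in> L \<and> B \<subseteq> U'}"
    have fin: "finite E" unfolding E_def using less.hyps[OF _ U'(1)] dm_strict_mono U' less.prems by blast
    have "H B \<in> E \<union> (\<lambda>f t. f t + (h t U Z - h t U' Z)) ` E" if B: "B \<in> L" "B \<subseteq> U" for B
    proof (cases "B \<subseteq> U'")
      case True
      then show ?thesis using B by (auto simp: E_def H_def)
    next
      case False
      have J: "join B U' \<in> L" "B \<subseteq> join B U'" "U' \<subseteq> join B U'" "join B U' \<subseteq> U"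
        using join_L[OF B(1) U'(1)] join_upper[OF B(1) U'(1)]
          join_least[OF B(1) U'(1) less.prems B(2)] U'(2) by auto
      then have "U' \<subset> join B U'" using False by blast
      then have "\<not> join B U' \<subset> U" using dm_strict_mono[OF U'(1) J(1)] max[OF J(1)] by auto
      then have U: "join B U' = U" using J by blast
      have BU: "B \<inter> U' \<in> L" using Int_L B U' by blast
      have "h t B Z = h t (B \<inter> U') Z + (h t U Z - h t U' Z)" for t
        using h_add[of B "B \<inter> U'" Z t] h_add[of U U' Z t] h_iso[OF B(1) U'(1), of t]
          U BU B U' Z_L Z_least less.prems by auto
      then have "H B = (\<lambda>f t. f t + (h t U Z - h t U' Z)) (H (B \<inter> U'))" by (simp add: H_def)
      moreover have "H (B \<inter> U') \<in> E" using BU by (auto simp: E_def H_def)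
      ultimately show ?thesis by blast
    qed
    then have "{(\<lambda>t. h t B Z) | B. B \<in> L \<and> B \<subseteq> U} \<subseteq> E \<union> (\<lambda>f t. f t + (h t U Z - h t U' Z)) ` E"
      unfolding H_def by blast
    then show ?thesis using fin finite_subset by blast
  qed
qed

section \<open>The descent in time\<close>

definition quotients_pos :: "real \<Rightarrow> 'a set \<Rightarrow> bool" where
  "quotients_pos t U \<longleftrightarrow> (\<forall>B. st U Z B \<longrightarrow> B \<noteq> U \<longrightarrow> h t U B > 0)"

text \<open>One step of the descent. The invariant \<open>quotients_pos\<close> is assumed for
  \<open>U\<close> at \<open>t0\<close> and recovered for the smaller \<open>B\<close> at the
  earlier time \<open>s\<close>, so the step can be iterated.\<close>

lemma semistable_top:
  assumes U: "U \<in> L" "U \<noteq> Z" "gq U Z" and pos: "quotients_pos t0 U"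
  shows "\<exists>s<t0. \<exists>B. st U Z B \<and> B \<noteq> U \<and> semistable s U B \<and> quotients_pos s B"
proof -
  define F where "F = {(\<lambda>t. h t U B) | B. st U Z B \<and> B \<noteq> U}"
  have hB: "h t U B = h t U Z - h t B Z" if "st U Z B" for B t
    using h_add[of U B Z t] that U Z_L by (auto simp: st_def)
  \<comment> \<open>Every member of \<open>F\<close> is one fixed function minus a member of the
    finite set from \<open>finite_values\<close>.\<close>
  have "F \<subseteq> (\<lambda>f t. h t U Z - f t) ` {(\<lambda>t. h t B Z) | B. B \<in> L \<and> B \<subseteq> U}"
  proof
    fix f assume "f \<in> F"
    then obtain B where B: "f = (\<lambda>t. h t U B)" "st U Z B" by (auto simp: F_def)
    then have "f = (\<lambda>f t. h t U Z - f t) (\<lambda>t. h t B Z)" using hB by auto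
    moreover have "(\<lambda>t. h t B Z) \<in> {(\<lambda>t. h t B Z) | B. B \<in> L \<and> B \<subseteq> U}"
      using B(2) unfolding st_def by blast
    ultimately show "f \<in> (\<lambda>f t. h t U Z - f t) ` {(\<lambda>t. h t B Z) | B. B \<in> L \<and> B \<subseteq> U}"
      by (rule image_eqI)
  qed
  then have fin: "finite F" using finite_values[OF U(1)] finite_subset by blast
  have cont: "continuous_on UNIV f" if "f \<in> F" for f
    using that h_continuous U by (auto simp: F_def st_def)
  obtain T where "\<forall>t<T. \<forall>U\<in>L. \<forall>V\<in>L. V \<subset> U \<longrightarrow> gq U V \<longrightarrow> h t U V < 0" using h_neg by blast
  \<comment> \<open>The time \<open>min t0 T - 1\<close> lies before both \<open>t0\<close> and the
    threshold \<open>T\<close>; there the quotient by \<open>B = Z\<close> is negative.\<close>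
  then have neg: "h (min t0 T - 1) U Z < 0" using U Z_L Z_least by (auto simp: psubset_eq)
  have "(\<lambda>t. h t U Z) \<in> F" using st_bot[of Z U] U Z_L Z_least by (auto simp: F_def)
  then have "\<exists>s<t0. (\<forall>f\<in>F. f s \<ge> 0) \<and> (\<exists>f\<in>F. f s = 0)"
    using fin cont pos neg
    by (intro last_nonpositive_time[of F t0 "\<lambda>t. h t U Z" "min t0 T - 1"])
      (auto simp: quotients_pos_def F_def)
  then obtain s where s: "s < t0" "\<And>f. f \<in> F \<Longrightarrow> f s \<ge> 0" "\<exists>f\<in>F. f s = 0" by blast
  have nonneg: "h s U B \<ge> 0" if "st U Z B" "B \<noteq> U" for B
    using s(2)[of "\<lambda>t. h t U B"] that by (auto simp: F_def)
  have zero: "\<exists>B. st U Z B \<and> B \<noteq> U \<and> h s U B = 0"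
    using s(3) by (auto simp: F_def)
  obtain B where B: "st U Z B" "B \<noteq> U" "h s U B = 0"
    and min: "\<And>C. st U Z C \<Longrightarrow> C \<noteq> U \<Longrightarrow> h s U C = 0 \<Longrightarrow> dm B \<le> dm C"
    using zero ex_has_least_nat[of "\<lambda>B. st U Z B \<and> B \<noteq> U \<and> h s U B = 0" _ dm] by metis
  have BL: "B \<in> L" "B \<subseteq> U" using B by (auto simp: st_def)
  have "semistable s U B"
    unfolding semistable_def
  proof (intro conjI allI impI)
    show "gq U B" using gq_quotient[of U B Z] U BL Z_L Z_least by blast
    fix A assume A: "st U B A"
    \<comment> \<open>\<open>A\<close> is strict in \<open>U\<close> as well, so its quotient is
      nonnegative at \<open>s\<close>. As \<open>h s U B = 0\<close>, additivity makes
      \<open>h s A B\<close> the negative of \<open>h s U A\<close>.\<close>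
    have "h s U A \<ge> 0"
      using nonneg[OF st_preimage[OF U(1) Z_L B(1) A]] h_add[of U U U s] U by (cases "A = U") auto
    then show "h s A B \<le> 0" using h_add[of U A B s] A U BL B(3) by (auto simp: st_def)
  qed (rule B(3))
  moreover have "quotients_pos s B"
    unfolding quotients_pos_def
  proof (intro allI impI)
    fix C assume C: "st B Z C" "C \<noteq> B"
    have CU: "st U Z C" using st_trans B C by blast
    have CL: "C \<in> L" "C \<subset> B" using C by (auto simp: st_def)
    \<comment> \<open>Minimality of \<open>B\<close> excludes \<open>h s U C = 0\<close> for the
      smaller \<open>C\<close>, leaving a positive value; it equals \<open>h s B C\<close> because
      \<open>h s U B = 0\<close>.\<close>
    then have "\<not> dm B \<le> dm C" using dm_strict_mono BL by force
    moreover have "C \<noteq> U" using CL BL by blast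
    ultimately have "h s U C > 0" using nonneg[OF CU] min[OF CU] by fastforce
    then show "h s B C > 0" using h_add[of U B C s] CL BL U B(3) by auto
  qed
  ultimately show ?thesis using s B by blast
qed

text \<open>The bound \<open>ts 1 < t0\<close> serves the induction: it places all times of the
  tail, which filters \<open>B\<close>, below the time \<open>s\<close> of the first step.\<close>

lemma semistable_filtration_below:
  assumes "U \<in> L" "gq U Z" "quotients_pos t0 U"
  shows "\<exists>(m::nat) ts Ms. (\<forall>k\<in>{1..<m}. ts k > ts (Suc k)) \<and> (1 \<le> m \<longrightarrow> ts 1 < t0) \<and>
    Ms 0 = U \<and> Ms m = Z \<and> (\<forall>k\<le>m. st U Z (Ms k)) \<and>
    (\<forall>k\<in>{1..m}. Ms k \<subseteq> Ms (k - 1) \<and> semistable (ts k) (Ms (k - 1)) (Ms k))"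
  using assms
proof (induction "dm U" arbitrary: U t0 rule: less_induct)
  case (less U)
  show ?case
  proof (cases "U = Z")
    case True
    then show ?thesis
      using Z_L st_bot[of Z Z] by (intro exI[of _ 0] exI[of _ "\<lambda>_. 0"] exI[of _ "\<lambda>_. Z"]) auto
  next
    case False
    obtain s B where s: "s < t0" and B: "st U Z B" "B \<noteq> U" "semistable s U B" "quotients_pos s B"
      using semistable_top[OF less.prems(1) False less.prems(2,3)] by blast
    have BL: "B \<in> L" "B \<subset> U" "gq B Z" using B by (auto simp: st_def)
    obtain m :: nat and ts Ms where M: "\<And>k. k \<in> {1..<m} \<Longrightarrow> ts k > ts (Suc k)" "1 \<le> m \<longrightarrow> ts 1 < s"
      "Ms 0 = B" "Ms m = Z" "\<And>k. k \<le> m \<Longrightarrow> st B Z (Ms k)"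
      "\<And>k. k \<in> {1..m} \<Longrightarrow> Ms k \<subseteq> Ms (k - 1) \<and> semistable (ts k) (Ms (k - 1)) (Ms k)"
      using less.hyps[OF dm_strict_mono[OF BL(1) less.prems(1) BL(2)] BL(1,3) B(4)] by blast
    \<comment> \<open>Times are counted from 1 and submodules from 0. Hence \<open>s\<close> is
      inserted at index 1, no condition concerns \<open>ts' 0\<close>, and
      \<open>case_nat U Ms\<close> has \<open>U\<close> at index 0.\<close>
    define ts' where "ts' k = (if k = 1 then s else ts (k - 1))" for k
    show ?thesis
    proof (intro exI[of _ "Suc m"] exI[of _ ts'] exI[of _ "case_nat U Ms"] conjI allI impI ballI)
      fix k assume k: "k \<in> {1..<Suc m}"
      then obtain i where i: "k = Suc i" "i < m" by (cases k) auto
      then show "ts' k > ts' (Suc k)" using M(1)[of i] M(2) by (cases i) (auto simp: ts'_def)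
    next
      fix k assume k: "k \<le> Suc m"
      show "st U Z (case_nat U Ms k)"
        using k M(5) st_trans[OF B(1)] st_top[OF less.prems(1) Z_least less.prems(2)] less.prems(1)
        by (cases k) auto
    next
      fix k assume k: "k \<in> {1..Suc m}"
      then obtain i where i: "k = Suc i" "i \<le> m" by (cases k) auto
      have "case_nat U Ms k \<subseteq> case_nat U Ms (k - 1) \<and>
        semistable (ts' k) (case_nat U Ms (k - 1)) (case_nat U Ms k)"
        using i M(3) M(6)[of i] BL B(3) by (cases i) (auto simp: ts'_def)
      then show "case_nat U Ms k \<subseteq> case_nat U Ms (k - 1)"
        "semistable (ts' k) (case_nat U Ms (k - 1)) (case_nat U Ms k)" by auto
    qed (use M s in \<open>auto simp: ts'_def\<close>)
  qed
qed

theorem semistable_filtration: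
  assumes "U \<in> L" "gq U Z"
  shows "\<exists>(m::nat) ts Ms. (\<forall>k\<in>{1..<m}. ts k > ts (Suc k)) \<and>
    Ms 0 = U \<and> Ms m = Z \<and> (\<forall>k\<le>m. st U Z (Ms k)) \<and>
    (\<forall>k\<in>{1..m}. Ms k \<subseteq> Ms (k - 1) \<and> semistable (ts k) (Ms (k - 1)) (Ms k))"
proof -
  obtain T where T: "\<forall>t>T. \<forall>U\<in>L. \<forall>V\<in>L. V \<subset> U \<longrightarrow> gq U V \<longrightarrow> h t U V > 0" using h_pos by blast
  \<comment> \<open>\<open>T + 1\<close> lies beyond the threshold of \<open>h_pos\<close>, which
    applies since quotients of \<open>U\<close> inherit \<open>gq\<close>.\<close>
  have "quotients_pos (T + 1) U"
    unfolding quotients_pos_def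
  proof (intro allI impI)
    fix B assume B: "st U Z B" "B \<noteq> U"
    then have "B \<in> L" "B \<subset> U" by (auto simp: st_def)
    moreover have "gq U B" using gq_quotient[of U B Z] calculation assms Z_L Z_least by blast
    ultimately show "h (T + 1) U B > 0" using T assms by simp
  qed
  from semistable_filtration_below[OF assms this] show ?thesis by metis
qed

end

section \<open>The lattice of submodules\<close>

locale green_path_module =
  fixes d :: nat and c :: "nat \<Rightarrow> nat \<Rightarrow> nat \<Rightarrow> 'k::field" and u :: "nat \<Rightarrow> 'k"
    and G :: "'k modl set" and \<theta> :: "real \<Rightarrow> 'k modl \<Rightarrow> real" and M :: "'k modl"
  assumes torsion: "torsion_class d c u G"
    and path: "smooth_green_path d c u G \<theta>"
    and M_in_G: "M \<in> G"
begin

section \<open>The torsion class and the path on subquotients of \<open>M\<close>\<close>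

definition gq :: "(nat \<Rightarrow> 'k) set \<Rightarrow> (nat \<Rightarrow> 'k) set \<Rightarrow> bool" where
  "gq U V \<longleftrightarrow> (\<exists>X\<in>G. subquot_iso d M U V X)"

text \<open>The chosen model does not matter, by \<open>h_eq\<close>: additive functions take equal
  values on isomorphic modules.\<close>

definition h :: "real \<Rightarrow> (nat \<Rightarrow> 'k) set \<Rightarrow> (nat \<Rightarrow> 'k) set \<Rightarrow> real" where
  "h t U V = \<theta> t (SOME X. is_module d c u X \<and> subquot_iso d M U V X)"

lemma G_is_module: "X \<in> G \<Longrightarrow> is_module d c u X"
  using torsion by (auto simp: torsion_class_def)

lemmas M_module = G_is_module[OF M_in_G]

lemma G_iso: "N \<in> G \<Longrightarrow> is_module d c u Q \<Longrightarrow> subquot_iso d N (vecs (fst N)) {0} Q \<Longrightarrow> Q \<in> G"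
  using torsion unfolding torsion_class_def zerov_eq_0 by metis

lemma G_quotient:
  "N \<in> G \<Longrightarrow> submodule d N U \<Longrightarrow> is_module d c u Q \<Longrightarrow> subquot_iso d N (vecs (fst N)) U Q \<Longrightarrow> Q \<in> G"
  using torsion unfolding torsion_class_def by metis

lemma G_extension:
  "is_module d c u N \<Longrightarrow> submodule d N U \<Longrightarrow> A \<in> G \<Longrightarrow> Q \<in> G \<Longrightarrow>
     subquot_iso d N U {0} A \<Longrightarrow> subquot_iso d N (vecs (fst N)) U Q \<Longrightarrow> N \<in> G"
  using torsion unfolding torsion_class_def zerov_eq_0 by metis

lemma additive: "additive d c u (\<theta> t)"
  using path by (simp add: smooth_green_path_def)

lemma gq_iff:
  assumes "submodule d M U" "is_module d c u X" "subquot_iso d M U V X"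
  shows "gq U V \<longleftrightarrow> X \<in> G"
proof
  assume "gq U V"
  then obtain Y where Y: "Y \<in> G" "subquot_iso d M U V Y" by (auto simp: gq_def)
  show "X \<in> G" using G_iso[OF Y(1) assms(2) subquotient_unique[OF Y(2) assms(3,1)]] .
qed (use assms(3) gq_def in blast)

lemma h_eq:
  assumes "submodule d M U" "is_module d c u X" "subquot_iso d M U V X"
  shows "h t U V = \<theta> t X"
proof -
  have "is_module d c u (SOME X. is_module d c u X \<and> subquot_iso d M U V X) \<and>
    subquot_iso d M U V (SOME X. is_module d c u X \<and> subquot_iso d M U V X)"
    using someI[of "\<lambda>X. is_module d c u X \<and> subquot_iso d M U V X" X] assms by blast
  then show ?thesis
    using additive_iso[OF additive _ assms(2) subquotient_unique[OF _ assms(3,1)], of _ t]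
    unfolding h_def by blast
qed

lemma subquotient_obtain:
  assumes "submodule d M U" "submodule d M V" "V \<subseteq> U"
  obtains X f where "is_module d c u X" "subquot_iso d M U V X" "presents d M U V X f"
  using subquotient_exists[OF M_module assms] subquot_iso_iff by blast

text \<open>The zero module lies in \<open>G\<close> as the quotient of \<open>M\<close> by
  itself.\<close>

lemma gq_refl: "submodule d M U \<Longrightarrow> gq U U"
proof -
  assume U: "submodule d M U"
  have "(0, \<lambda>_ _ _. 0) \<in> G"
    using G_quotient[OF M_in_G submodule_vecs is_module_zero subquot_iso_zero[OF submodule_vecs]] .
  then show ?thesis using subquot_iso_zero[OF U] unfolding gq_def by blast
qed

text \<open>By \<open>presents_nested\<close> the quotient of \<open>U\<close> by \<open>V\<close>
  is a quotient of the model \<open>X\<close>, so closure of \<open>G\<close> under quotients is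
  applied to \<open>X\<close>. Extensions and additivity are handled in the same way.\<close>

lemma gq_quotient:
  assumes L: "submodule d M U" "submodule d M V" "submodule d M W"
    and sub: "W \<subseteq> V" "V \<subseteq> U" and gq: "gq U W"
  shows "gq U V"
proof -
  obtain X f where X: "X \<in> G" and f: "presents d M U W X f"
    using gq by (auto simp: gq_def subquot_iso_iff)
  obtain Q where Q: "is_module d c u Q" "subquot_iso d M U V Q"
    using subquotient_obtain[OF L(1,2) sub(2)] by blast
  then have "subquot_iso d X (vecs (fst X)) (f ` V) Q"
    using presents_nested(2)[OF f G_is_module[OF X] L(1,2) sub] by blast
  then have "Q \<in> G" using G_quotient[OF X submodule_image[OF f L(2) sub(2)] Q(1)] by blast
  then show ?thesis using Q by (auto simp: gq_def)
qed

lemma gq_extension: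
  assumes L: "submodule d M U" "submodule d M V" "submodule d M W"
    and sub: "W \<subseteq> V" "V \<subseteq> U" and gq: "gq U V" "gq V W"
  shows "gq U W"
proof -
  obtain X f where X: "is_module d c u X" "subquot_iso d M U W X" and f: "presents d M U W X f"
    using subquotient_obtain[OF L(1,3)] sub by blast
  obtain Q where Q: "Q \<in> G" "subquot_iso d M U V Q" using gq by (auto simp: gq_def)
  obtain A where A: "A \<in> G" "subquot_iso d M V W A" using gq by (auto simp: gq_def)
  have "X \<in> G"
    using G_extension[OF X(1) submodule_image[OF f L(2) sub(2)] A(1) Q(1)]
      presents_nested[OF f X(1) L(1,2) sub] A Q by blast
  then show ?thesis using X by (auto simp: gq_def)
qed

lemma h_add:
  assumes L: "submodule d M U" "submodule d M V" "submodule d M W" and sub: "W \<subseteq> V" "V \<subseteq> U"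
  shows "h t U W = h t U V + h t V W"
proof -
  obtain X f where X: "is_module d c u X" "subquot_iso d M U W X" and f: "presents d M U W X f"
    using subquotient_obtain[OF L(1,3)] sub by blast
  obtain Q where Q: "is_module d c u Q" "subquot_iso d M U V Q"
    using subquotient_obtain[OF L(1,2) sub(2)] by blast
  obtain A where A: "is_module d c u A" "subquot_iso d M V W A"
    using subquotient_obtain[OF L(2,3) sub(1)] by blast
  have "\<theta> t X = \<theta> t A + \<theta> t Q"
    using additive[of t] X(1) A Q submodule_image[OF f L(2) sub(2)]
      presents_nested[OF f X(1) L(1,2) sub]
    unfolding additive_def zerov_eq_0 by blast
  then show ?thesis using h_eq L X A Q by simp
qed

lemma h_continuous:
  assumes "submodule d M U" "submodule d M V" "V \<subseteq> U"
  shows "continuous_on UNIV (\<lambda>t. h t U V)"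
proof -
  obtain X where X: "is_module d c u X" "subquot_iso d M U V X"
    using subquotient_obtain[OF assms] by blast
  \<comment> \<open>The instance \<open>k = 0\<close> of smoothness is differentiability of the path
    itself, which gives continuity.\<close>
  have "((deriv ^^ 0) (\<lambda>t. \<theta> t X)) differentiable (at t)" for t
    using path X(1) unfolding smooth_green_path_def smooth_real_def by blast
  then have "continuous_on UNIV (\<lambda>t. \<theta> t X)"
    by (auto intro!: continuous_at_imp_continuous_on differentiable_imp_continuous_within)
  then show ?thesis using h_eq[OF assms(1) X] by simp
qed

lemma gq_nonzero_obtain:
  assumes "submodule d M U" "V \<subset> U" "gq U V"
  obtains X where "X \<in> G" "fst X \<noteq> 0" "\<And>t. h t U V = \<theta> t X"
proof -
  obtain X f where X: "X \<in> G" "subquot_iso d M U V X" "presents d M U V X f"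
    using assms(3) by (auto simp: gq_def subquot_iso_iff)
  then have "fst X \<noteq> 0" using presents_zero_dim assms(2) by blast
  then show ?thesis using that X h_eq[OF assms(1) G_is_module] by blast
qed

text \<open>The closure properties of \<open>G\<close> turn into those of \<open>gq\<close>,
  additivity into \<open>h_add\<close>, and the positive and negative ends of the green path into
  \<open>h_pos\<close> and \<open>h_neg\<close>.\<close>

sublocale stability_lattice "{U. submodule d M U}" vsum "{0}" fv.dim gq h
proof unfold_locales
  fix A B assume AB: "A \<in> {U. submodule d M U}" "B \<in> {U. submodule d M U}"
  then show "A \<inter> B \<in> {U. submodule d M U}" "vsum A B \<in> {U. submodule d M U}"
    using submodule_Int[of d M A B] submodule_vsum[of d M A B] by simp_all
  show "A \<subseteq> vsum A B \<and> B \<subseteq> vsum A B"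
    using AB subset_vsum1[of B A] subset_vsum2[of A B] submodule_0[of d M] by simp
  show "fv.dim A < fv.dim B" if "A \<subset> B"
    using AB that dim_strict_mono[of A B "fst M"] by (simp add: submodule_iff)
  show "gq A (A \<inter> B) \<longleftrightarrow> gq (vsum A B) B"
    using AB subquot_iso_second_isomorphism[OF M_module] by (simp add: gq_def)
  \<comment> \<open>By the second isomorphism theorem both choices in \<open>h\<close> range over
    the same models, so they select the same module.\<close>
  show "h t A (A \<inter> B) = h t (vsum A B) B" for t
    using AB subquot_iso_second_isomorphism[OF M_module] by (simp add: h_def)
  show "vsum A B \<subseteq> C" if "C \<in> {U. submodule d M U}" "A \<subseteq> C" "B \<subseteq> C" for C
    using that vsum_least[of C A B] by (simp add: submodule_iff)
  show "vsum A B \<inter> C = vsum (A \<inter> C) B" if "C \<in> {U. submodule d M U}" "B \<subseteq> C" for C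
    using that vsum_modular[of C B A] by (simp add: submodule_iff)
  show "continuous_on UNIV (\<lambda>t. h t A B)" if "B \<subseteq> A"
    using AB that h_continuous[of A B] by simp
next
  obtain T where T: "\<forall>t>T. \<forall>X. X \<in> G \<and> fst X \<noteq> 0 \<longrightarrow> \<theta> t X > 0"
    using path unfolding smooth_green_path_def by blast
  have "h t U V > 0" if t: "t > T" and UV: "submodule d M U" "V \<subset> U" "gq U V" for t U V
    using gq_nonzero_obtain[OF UV] T t by metis
  then show "\<exists>T. \<forall>t>T. \<forall>U\<in>{U. submodule d M U}. \<forall>V\<in>{U. submodule d M U}.
      V \<subset> U \<longrightarrow> gq U V \<longrightarrow> 0 < h t U V"
    by blast
  obtain T' where T': "\<forall>t<T'. \<forall>X. X \<in> G \<and> fst X \<noteq> 0 \<longrightarrow> \<theta> t X < 0"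
    using path unfolding smooth_green_path_def by blast
  have "h t U V < 0" if t: "t < T'" and UV: "submodule d M U" "V \<subset> U" "gq U V" for t U V
    using gq_nonzero_obtain[OF UV] T' t by metis
  then show "\<exists>T. \<forall>t<T. \<forall>U\<in>{U. submodule d M U}. \<forall>V\<in>{U. submodule d M U}.
      V \<subset> U \<longrightarrow> gq U V \<longrightarrow> h t U V < 0"
    by blast
next
  fix A assume "A \<in> {U. submodule d M U}"
  then show "{0} \<subseteq> A" "gq A A" using submodule_0[of d M A] gq_refl by simp_all
next
  fix U V W assume *: "U \<in> {U. submodule d M U}" "V \<in> {U. submodule d M U}"
    "W \<in> {U. submodule d M U}" "W \<subseteq> V" "V \<subseteq> U"
  then show "h t U W = h t U V + h t V W" for t using h_add[of U V W t] by simp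
  show "gq U V" if "gq U W" using gq_quotient[of U V W] * that by simp
  show "gq U W" if "gq U V" "gq V W" using gq_extension[of U V W] * that by simp
qed (simp add: submodule_zero)

section \<open>Strict subobjects and semistability of a subquotient, read off in
  \<open>M\<close>\<close>

lemma sub_in_iff: "sub_in d c u G M U \<longleftrightarrow> gq U {0}"
  using G_is_module unfolding sub_in_def gq_def zerov_eq_0 by blast

lemma strict_subobject_iff_st:
  "strict_subobject d c u G M W \<longleftrightarrow> st (vecs (fst M)) {0} W"
proof -
  have "{0} \<subseteq> C \<and> C \<subseteq> vecs (fst M)" if "submodule d M C" for C
    using submodule_0[OF that] that by (simp add: submodule_iff)
  then show ?thesis
    unfolding strict_subobject_def subobject_def sub_in_iff st_def Ball_def mem_Collect_eq
    by (smt (verit))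
qed

context
  fixes U V X f
  assumes U: "submodule d M U" and V: "submodule d M V" "V \<subseteq> U"
    and X: "is_module d c u X" and f: "presents d M U V X f"
begin

lemma preimage_zero: "{v\<in>U. f v \<in> {0}} = V"
  using f by (auto simp: presents_def)

lemma subquotient_sub_iso:
  assumes "submodule d X W"
  shows "subquot_iso d X W {0} Y \<longleftrightarrow> subquot_iso d M {v\<in>U. f v \<in> W} V Y"
  using subquot_iso_correspondence[OF f U X assms submodule_zero] submodule_0[OF assms]
  unfolding preimage_zero by simp

lemma subquotient_sub_in:
  assumes "submodule d X W"
  shows "sub_in d c u G X W \<longleftrightarrow> gq {v\<in>U. f v \<in> W} V"
  using subquotient_sub_iso[OF assms] G_is_module unfolding sub_in_def gq_def zerov_eq_0 by blast

lemma subset_preimage: "submodule d X W \<Longrightarrow> V \<subseteq> {v\<in>U. f v \<in> W}"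
  using f submodule_0[of d X W] by (auto simp: presents_def)

text \<open>Test submodules of \<open>X\<close> correspond to those between \<open>V\<close> and
  \<open>U\<close> by taking images and preimages under \<open>f\<close>, and preimages commute with
  intersections.\<close>

lemma subquotient_strict_iff:
  assumes W: "submodule d X W"
  shows "strict_subobject d c u G X W \<longleftrightarrow> st U V {v\<in>U. f v \<in> W}"
proof
  assume *: "strict_subobject d c u G X W"
  show "st U V {v\<in>U. f v \<in> W}"
    unfolding st_def
  proof (intro conjI ballI impI)
    show "gq {v\<in>U. f v \<in> W} V"
      using * subquotient_sub_in[OF W] by (simp add: strict_subobject_def subobject_def)
    fix C assume C: "C \<in> {U. submodule d M U}" "V \<subseteq> C" "C \<subseteq> U" "gq C V"
    have pre: "{v\<in>U. f v \<in> f ` C} = C" using preimage_image[OF f U] C by blast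
    have fC: "submodule d X (f ` C)" using submodule_image[OF f] C by blast
    then have "sub_in d c u G X (W \<inter> f ` C)"
      using * C(4) subquotient_sub_in[OF fC] pre by (simp add: strict_subobject_def subobject_def)
    then have "gq {v\<in>U. f v \<in> W \<inter> f ` C} V"
      using subquotient_sub_in[OF submodule_Int[OF W fC]] by blast
    moreover have "{v\<in>U. f v \<in> W \<inter> f ` C} = {v\<in>U. f v \<in> W} \<inter> C" using pre by blast
    ultimately show "gq ({v\<in>U. f v \<in> W} \<inter> C) V" by simp
  qed (use W submodule_preimage[OF f U W] subset_preimage in auto)
next
  assume *: "st U V {v\<in>U. f v \<in> W}"
  show "strict_subobject d c u G X W"
    unfolding strict_subobject_def subobject_def
  proof (intro conjI allI impI)
    show "sub_in d c u G X W" using * subquotient_sub_in[OF W] by (simp add: st_def)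
    fix W' assume W': "submodule d X W' \<and> sub_in d c u G X W'"
    then have "gq ({v\<in>U. f v \<in> W} \<inter> {v\<in>U. f v \<in> W'}) V"
      using * subquotient_sub_in[of W'] submodule_preimage[OF f U, of W'] subset_preimage[of W']
      unfolding st_def by blast
    moreover have "{v\<in>U. f v \<in> W} \<inter> {v\<in>U. f v \<in> W'} = {v\<in>U. f v \<in> W \<inter> W'}" by blast
    ultimately show "sub_in d c u G X (W \<inter> W')"
      using subquotient_sub_in[OF submodule_Int[OF W, of W']] W' by simp
  qed (rule W)
qed

text \<open>Both stability conditions test the same objects: \<open>A\<close> is sent to its image
  and \<open>W\<close> to its preimage, and \<open>h_eq\<close> matches the values.\<close>

lemma subquotient_in_W_iff: "in_W d c u G (\<theta> t) X \<longleftrightarrow> semistable t U V"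
proof -
  have iso: "subquot_iso d M U V X" using f subquot_iso_iff by blast
  have "(\<forall>W Y. strict_subobject d c u G X W \<and> is_module d c u Y \<and> subquot_iso d X W {0} Y
          \<longrightarrow> \<theta> t Y \<le> 0) \<longleftrightarrow> (\<forall>A. st U V A \<longrightarrow> h t A V \<le> 0)" (is "?l \<longleftrightarrow> ?r")
  proof
    assume l: ?l
    show ?r
    proof (intro allI impI)
      fix A assume A: "st U V A"
      then have AL: "submodule d M A" "V \<subseteq> A" "A \<subseteq> U" by (auto simp: st_def)
      obtain Y where Y: "is_module d c u Y" "subquot_iso d M A V Y"
        using subquotient_obtain[OF AL(1) V(1) AL(2)] by blast
      have "strict_subobject d c u G X (f ` A)"
        using subquotient_strict_iff[OF submodule_image[OF f AL(1,3)]]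
          preimage_image[OF f U AL(1,3,2)] A by simp
      then have "\<theta> t Y \<le> 0" using l presents_nested(1)[OF f X U AL(1,2,3)] Y by blast
      then show "h t A V \<le> 0" using h_eq[OF AL(1) Y] by simp
    qed
  next
    assume r: ?r
    show ?l
    proof (intro allI impI)
      fix W Y
      assume *: "strict_subobject d c u G X W \<and> is_module d c u Y \<and> subquot_iso d X W {0} Y"
      then have W: "submodule d X W" by (simp add: strict_subobject_def subobject_def)
      have "h t {v\<in>U. f v \<in> W} V \<le> 0" using r subquotient_strict_iff[OF W] * by blast
      then show "\<theta> t Y \<le> 0"
        using h_eq[OF submodule_preimage[OF f U W], of Y V t] subquotient_sub_iso[OF W] * by simp
    qed
  qed
  then show ?thesis
    unfolding in_W_def in_D_def semistable_def zerov_eq_0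
    using gq_iff[OF U X iso] h_eq[OF U X iso] by simp
qed

end

text \<open>A destabilizing \<open>W\<close> in \<open>X\<close> would pull back to a submodule
  \<open>A\<close> strictly between \<open>V\<close> and \<open>U\<close> that contradicts
  stability. Here \<open>Y\<close> is also a model of \<open>A\<close> modulo \<open>V\<close>, so
  its membership in \<open>W\<close> makes that quotient semistable.\<close>

lemma subquotient_in_W0:
  assumes U: "submodule d M U" and V: "submodule d M V" "V \<subseteq> U"
    and X: "is_module d c u X" and f: "presents d M U V X f" and stable: "stable t U V"
  shows "in_W0 d c u G (\<theta> t) X"
  unfolding in_W0_def zerov_eq_0
proof (intro conjI notI)
  show "in_W d c u G (\<theta> t) X"
    using subquotient_in_W_iff[OF U V X f] stable by (simp add: stable_def)
  show False if "fst X = 0"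
    using presents_zero_dim[OF f that] stable by (simp add: stable_def)
  assume "\<exists>W Y. strict_subobject d c u G X W \<and> W \<noteq> {0} \<and> W \<noteq> vecs (fst X) \<and>
    is_module d c u Y \<and> subquot_iso d X W {0} Y \<and> in_W d c u G (\<theta> t) Y"
  then obtain W Y where W: "strict_subobject d c u G X W" "W \<noteq> {0}" "W \<noteq> vecs (fst X)"
    and Y: "is_module d c u Y" "subquot_iso d X W {0} Y" "in_W d c u G (\<theta> t) Y" by blast
  have WX: "submodule d X W" using W by (simp add: strict_subobject_def subobject_def)
  define A where "A = {v\<in>U. f v \<in> W}"
  have A: "submodule d M A" "V \<subseteq> A" "st U V A"
    using submodule_preimage[OF f U WX] subset_preimage[OF U V X f WX]
      subquotient_strict_iff[OF U V X f WX] W by (auto simp: A_def)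
  have fA: "f ` A = W" unfolding A_def using image_preimage[OF f] WX by (simp add: submodule_iff)
  have "f ` V = {0}" using presents_image_kernel[OF f V(1)] .
  \<comment> \<open>Applying \<open>f\<close>, the case \<open>A = V\<close> would make
    \<open>W\<close> zero and \<open>A = U\<close> would make it all of \<open>X\<close>.\<close>
  then have "A \<noteq> V" "A \<noteq> U" using fA W f by (auto simp: presents_def)
  moreover have "subquot_iso d M A V Y"
    using subquotient_sub_iso[OF U V X f WX] Y by (simp add: A_def)
  then have "semistable t A V"
    using subquotient_in_W_iff[OF A(1) V(1) A(2) Y(1)] Y(3) subquot_iso_iff by blast
  ultimately show False using A stable by (auto simp: stable_def)
qed

text \<open>The chain from \<open>stable_filtration\<close> is pushed into \<open>X\<close> by
  \<open>f\<close>; the correspondence theorem identifies its factors with the stable subquotients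
  of \<open>M\<close>.\<close>

lemma subquotient_stable_filtration:
  assumes U: "submodule d M U" and V: "submodule d M V" "V \<subseteq> U"
    and X: "is_module d c u X" and f: "presents d M U V X f" and ss: "semistable t U V"
  shows "\<exists>(r::nat) Ns. Ns 0 = {0} \<and> Ns r = vecs (fst X) \<and>
    (\<forall>j\<le>r. strict_subobject d c u G X (Ns j)) \<and>
    (\<forall>j\<in>{1..r}. Ns (j - 1) \<subseteq> Ns j \<and>
       (\<exists>Y. is_module d c u Y \<and> subquot_iso d X (Ns j) (Ns (j - 1)) Y \<and> in_W0 d c u G (\<theta> t) Y))"
proof -
  obtain r :: nat and Ns where N: "Ns 0 = V" "Ns r = U" "\<And>j. j \<le> r \<Longrightarrow> st U V (Ns j)"
    "\<And>j. j \<in> {1..r} \<Longrightarrow> Ns (j - 1) \<subseteq> Ns j \<and> stable t (Ns j) (Ns (j - 1))"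
    using stable_filtration[OF CollectI[of "submodule d M", OF U] CollectI[of "submodule d M", OF V(1)] V(2) ss]
    by blast
  have NL: "submodule d M (Ns j)" "V \<subseteq> Ns j" "Ns j \<subseteq> U" if "j \<le> r" for j
    using N(3)[OF that] by (auto simp: st_def)
  have pre: "{v\<in>U. f v \<in> f ` Ns j} = Ns j" if "j \<le> r" for j
    using preimage_image[OF f U NL(1,3,2)] that by blast
  have im: "submodule d X (f ` Ns j)" if "j \<le> r" for j
    using submodule_image[OF f NL(1,3)] that by blast
  show ?thesis
  proof (intro exI[of _ r] exI[of _ "\<lambda>j. f ` Ns j"] conjI allI impI ballI)
    show "f ` Ns 0 = {0}" using presents_image_kernel[OF f V(1)] N(1) by simp
    show "f ` Ns r = vecs (fst X)" using f N(2) by (simp add: presents_def)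
    show "strict_subobject d c u G X (f ` Ns j)" if "j \<le> r" for j
      using subquotient_strict_iff[OF U V X f im] pre N(3) that by simp
    fix j assume j: "j \<in> {1..r}"
    then have jr: "j \<le> r" "j - 1 \<le> r" by auto
    have sub: "Ns (j - 1) \<subseteq> Ns j" and stab: "stable t (Ns j) (Ns (j - 1))" using N(4)[OF j] by auto
    show "f ` Ns (j - 1) \<subseteq> f ` Ns j" using sub by blast
    obtain Y g where Y: "is_module d c u Y" "subquot_iso d M (Ns j) (Ns (j - 1)) Y"
      and g: "presents d M (Ns j) (Ns (j - 1)) Y g"
      using subquotient_obtain[OF NL(1)[OF jr(1)] NL(1)[OF jr(2)] sub] by blast
    have "subquot_iso d X (f ` Ns j) (f ` Ns (j - 1)) Y"
      using subquot_iso_correspondence[OF f U X im[OF jr(1)] im[OF jr(2)] image_mono[OF sub]]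
        Y(2) pre jr by simp
    moreover have "in_W0 d c u G (\<theta> t) Y"
      using subquotient_in_W0[OF NL(1)[OF jr(1)] NL(1)[OF jr(2)] sub Y(1) g stab] .
    ultimately show "\<exists>Y. is_module d c u Y \<and> subquot_iso d X (f ` Ns j) (f ` Ns (j - 1)) Y \<and>
        in_W0 d c u G (\<theta> t) Y"
      using Y(1) by blast
  qed
qed

end

section \<open>Harder-Narasimhan filtration of \<open>M\<close> and its stable refinement\<close>

theorem mainTheorem18:
  fixes d :: nat and c :: "nat \<Rightarrow> nat \<Rightarrow> nat \<Rightarrow> 'k::field" and u :: "nat \<Rightarrow> 'k"
    and G :: "'k modl set" and \<theta> :: "real \<Rightarrow> 'k modl \<Rightarrow> real" and M :: "'k modl"
  assumes "fd_algebra d c u"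
    and "torsion_class d c u G"
    and "smooth_green_path d c u G \<theta>"
    and "M \<in> G"
  shows "\<exists>(m::nat) (ts::nat \<Rightarrow> real) (Ms::nat \<Rightarrow> (nat \<Rightarrow> 'k) set).
     (\<forall>k\<in>{1..<m}. ts k > ts (Suc k)) \<and>
     Ms 0 = vecs (fst M) \<and> Ms m = {zerov} \<and>
     (\<forall>k\<le>m. strict_subobject d c u G M (Ms k)) \<and>
     (\<forall>k\<in>{1..m}. Ms k \<subseteq> Ms (k - 1) \<and>
        (\<exists>X. is_module d c u X \<and> subquot_iso d M (Ms (k - 1)) (Ms k) X \<and>
             in_W d c u G (\<theta> (ts k)) X \<and>
             (\<exists>(r::nat) (Ns::nat \<Rightarrow> (nat \<Rightarrow> 'k) set).
                Ns 0 = {zerov} \<and> Ns r = vecs (fst X) \<and>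
                (\<forall>j\<le>r. strict_subobject d c u G X (Ns j)) \<and>
                (\<forall>j\<in>{1..r}. Ns (j - 1) \<subseteq> Ns j \<and>
                   (\<exists>Y. is_module d c u Y \<and> subquot_iso d X (Ns j) (Ns (j - 1)) Y \<and>
                        in_W0 d c u G (\<theta> (ts k)) Y)))))"
proof -
  interpret green_path_module d c u G \<theta> M by (rule green_path_module.intro) (fact assms)+
  \<comment> \<open>\<open>M\<close> itself is a model of the quotient of its full space by
    zero.\<close>
  have top: "gq (vecs (fst M)) {0}" using M_in_G subquot_iso_refl unfolding gq_def by blast
  obtain m :: nat and ts Ms where
    *: "(\<forall>k\<in>{1..<m}. ts k > ts (Suc k)) \<and> Ms 0 = vecs (fst M) \<and> Ms m = {0} \<and>
      (\<forall>k\<le>m. st (vecs (fst M)) {0} (Ms k)) \<and>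
      (\<forall>k\<in>{1..m}. Ms k \<subseteq> Ms (k - 1) \<and> semistable (ts k) (Ms (k - 1)) (Ms k))"
    using semistable_filtration[OF CollectI[of "submodule d M", OF submodule_vecs] top]
    by (elim exE)
  from * have ts: "\<forall>k\<in>{1..<m}. ts k > ts (Suc k)" by (elim conjE)
  from * have Ms0: "Ms 0 = vecs (fst M)" by (elim conjE)
  from * have Msm: "Ms m = {0}" by (elim conjE)
  from * have st: "\<forall>k\<le>m. st (vecs (fst M)) {0} (Ms k)" by (elim conjE)
  from * have ss: "\<forall>k\<in>{1..m}. Ms k \<subseteq> Ms (k - 1) \<and> semistable (ts k) (Ms (k - 1)) (Ms k)"
    by (elim conjE)
  have MsL: "submodule d M (Ms k)" if "k \<le> m" for k using st that by (simp add: st_def)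
  show ?thesis
    unfolding zerov_eq_0
  proof (intro exI[of _ m] exI[of _ ts] exI[of _ Ms] conjI ballI)
    show "\<forall>k\<le>m. strict_subobject d c u G M (Ms k)" using st strict_subobject_iff_st by blast
    fix k assume k: "k \<in> {1..m}"
    then have L: "submodule d M (Ms (k - 1))" "submodule d M (Ms k)" using MsL by auto
    show sub: "Ms k \<subseteq> Ms (k - 1)" using ss k by blast
    have ssk: "semistable (ts k) (Ms (k - 1)) (Ms k)" using ss k by blast
    \<comment> \<open>A single model \<open>X\<close> of the factor serves for both membership in
      \<open>W\<close> and the chain with factors in \<open>in_W0\<close>.\<close>
    obtain X f where X: "is_module d c u X" "subquot_iso d M (Ms (k - 1)) (Ms k) X"
      and f: "presents d M (Ms (k - 1)) (Ms k) X f"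
      using subquotient_obtain[OF L sub] by blast
    show "\<exists>X. is_module d c u X \<and> subquot_iso d M (Ms (k - 1)) (Ms k) X \<and>
             in_W d c u G (\<theta> (ts k)) X \<and>
             (\<exists>(r::nat) (Ns::nat \<Rightarrow> (nat \<Rightarrow> 'k) set).
                Ns 0 = {0} \<and> Ns r = vecs (fst X) \<and>
                (\<forall>j\<le>r. strict_subobject d c u G X (Ns j)) \<and>
                (\<forall>j\<in>{1..r}. Ns (j - 1) \<subseteq> Ns j \<and>
                   (\<exists>Y. is_module d c u Y \<and> subquot_iso d X (Ns j) (Ns (j - 1)) Y \<and>
                        in_W0 d c u G (\<theta> (ts k)) Y)))"
      using X subquotient_in_W_iff[OF L sub X(1) f] ssk
        subquotient_stable_filtration[OF L sub X(1) f ssk]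
      by (intro exI[of _ X] conjI) simp_all
  qed (fact Ms0 Msm ts[rule_format])+
qed

end
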